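(* Starting from an empty $n$-node graph, one can process the first $T$ updates in a dynamic stream so as to maintain a random subset of edges $F^{(t)} \subseteq E^{(t)}$ at each time-step $t \leq T$, using $\tilde O(n)$ space and $\tilde O(1)$ worst-case update time, such that with high probability $F^{(t)} = E^{(t)}$ at every time-step $t \leq T$ with $m^{(t)} \leq 8 \alpha c^2 n \log^2 n$.
   Context: Standing parameters: $\epsilon\in(0,1)$ is a sufficiently small constant; $\alpha=2+c^*\epsilon$ for a constant $c^*$ independent of $\epsilon$; $\lambda\ge1$ is a constant and $c$ is a constant with $c\gg\lambda$; $T=\lceil n^{\lambda}\rceil$. The graph $G=(V,E)$ has fixed node set $V$, $|V|=n$, starts with no edges, and each update of the stream inserts a new edge or deletes an existing one; $G^{(t)}=(V,E^{(t)})$ is the graph after $t$ updates and $m^{(t)}=|E^{(t)}|$. The update sequence is fixed independently of the algorithm's random bits. $\tilde O(\cdot)$ hides $\mathrm{poly}(\log n,1/\epsilon)$ factors; "with high probability" means with probability at least $1-1/\mathrm{poly}(n)$. *)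

theory Defs
  imports "HOL-Probability.Probability"
begin

subsection \<open>Dynamic streams\<close>

text \<open>Nodes are \<open>0, \<dots>, n - 1\<close>. An update names its edge by an ordered pair of end points, in
  an order chosen by the stream; the edge itself is the unordered pair.\<close>

datatype update = Insert nat nat | Delete nat nat

fun apply_update :: "update \<Rightarrow> nat set set \<Rightarrow> nat set set" where
  "apply_update (Insert u v) E = insert {u, v} E"
| "apply_update (Delete u v) E = E - {{u, v}}"

fun legal_update :: "nat \<Rightarrow> nat set set \<Rightarrow> update \<Rightarrow> bool" where
  "legal_update n E (Insert u v) \<longleftrightarrow> u < n \<and> v < n \<and> u \<noteq> v \<and> {u, v} \<notin> E"
| "legal_update n E (Delete u v) \<longleftrightarrow> {u, v} \<in> E"

text \<open>\<open>graph_edges upd t\<close> is $E^{(t)}$; update number \<open>t + 1\<close> of the stream is \<open>upd t\<close>.\<close>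

fun graph_edges :: "(nat \<Rightarrow> update) \<Rightarrow> nat \<Rightarrow> nat set set" where
  "graph_edges upd 0 = {}"
| "graph_edges upd (Suc t) = apply_update (upd t) (graph_edges upd t)"

definition legal_stream :: "nat \<Rightarrow> nat \<Rightarrow> (nat \<Rightarrow> update) \<Rightarrow> bool" where
  "legal_stream n T upd \<longleftrightarrow> (\<forall>t<T. legal_update n (graph_edges upd t) (upd t))"


subsection \<open>A randomized word RAM\<close>

text \<open>The memory consists of \<open>S\<close> cells, each holding a word of \<open>w\<close> bits. Operands are cell
  addresses. There is no derivation of \<open>exec w S\<close> for a program that uses an address
  \<open>\<ge> S\<close> or produces a number \<open>\<ge> 2 ^ w\<close>, so the existence of a derivation includes the space
  bound. A coin that has been tossed is not accessible again unless the program stores it.\<close>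

datatype binop = Add | Sub | Mul | Div | Mod

fun binop_val :: "binop \<Rightarrow> nat \<Rightarrow> nat \<Rightarrow> nat" where
  "binop_val Add x y = x + y"
| "binop_val Sub x y = x - y"
| "binop_val Mul x y = x * y"
| "binop_val Div x y = x div y"
| "binop_val Mod x y = x mod y"

datatype prog =
    Skip
  | SetConst nat nat
  | Op binop nat nat nat
  | Load nat nat
  | Store nat nat
  | Flip nat
  | Seq prog prog
  | IfNZ nat prog prog
  | WhileNZ nat prog

text \<open>A state is the memory together with the coins not yet tossed.\<close>

type_synonym state = "(nat \<Rightarrow> nat) \<times> bool stream"

text \<open>\<open>exec w S p s k s'\<close>: started in \<open>s\<close>, program \<open>p\<close> halts in \<open>s'\<close> after \<open>k\<close> steps.\<close>

inductive exec :: "nat \<Rightarrow> nat \<Rightarrow> prog \<Rightarrow> state \<Rightarrow> nat \<Rightarrow> state \<Rightarrow> bool" for w S :: nat where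
  Skip: "exec w S Skip s 1 s"
| SetConst: "a < S \<Longrightarrow> x < 2 ^ w \<Longrightarrow> exec w S (SetConst a x) (m, \<omega>) 1 (m(a := x), \<omega>)"
| Op: "a < S \<Longrightarrow> b < S \<Longrightarrow> c < S \<Longrightarrow> binop_val f (m b) (m c) < 2 ^ w \<Longrightarrow>
    exec w S (Op f a b c) (m, \<omega>) 1 (m(a := binop_val f (m b) (m c)), \<omega>)"
| Load: "a < S \<Longrightarrow> b < S \<Longrightarrow> m b < S \<Longrightarrow>
    exec w S (Load a b) (m, \<omega>) 1 (m(a := m (m b)), \<omega>)"
| Store: "a < S \<Longrightarrow> b < S \<Longrightarrow> m a < S \<Longrightarrow>
    exec w S (Store a b) (m, \<omega>) 1 (m(m a := m b), \<omega>)"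
| Flip: "a < S \<Longrightarrow> exec w S (Flip a) (m, \<omega>) 1 (m(a := of_bool (shd \<omega>)), stl \<omega>)"
| Seq: "exec w S p s k s' \<Longrightarrow> exec w S q s' l s'' \<Longrightarrow> exec w S (Seq p q) s (k + l) s''"
| IfTrue: "a < S \<Longrightarrow> fst s a \<noteq> 0 \<Longrightarrow> exec w S p s k s' \<Longrightarrow>
    exec w S (IfNZ a p q) s (Suc k) s'"
| IfFalse: "a < S \<Longrightarrow> fst s a = 0 \<Longrightarrow> exec w S q s k s' \<Longrightarrow>
    exec w S (IfNZ a p q) s (Suc k) s'"
| WhileFalse: "a < S \<Longrightarrow> fst s a = 0 \<Longrightarrow> exec w S (WhileNZ a p) s 1 s"
| WhileTrue: "a < S \<Longrightarrow> fst s a \<noteq> 0 \<Longrightarrow> exec w S p s k s' \<Longrightarrow>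
    exec w S (WhileNZ a p) s' l s'' \<Longrightarrow> exec w S (WhileNZ a p) s (Suc (k + l)) s''"

lemma exec_deterministic:
  "exec w S p s k s' \<Longrightarrow> exec w S p s l s'' \<Longrightarrow> l = k \<and> s'' = s'"
proof (induction arbitrary: l s'' rule: exec.induct)
  case (Seq p s k s' q l' t)
  from Seq.prems obtain k1 s1 l1
    where "exec w S p s k1 s1" "exec w S q s1 l1 s''" "l = k1 + l1"
    by (cases rule: exec.cases) simp_all
  with Seq.IH show ?case by metis
next
  case (IfTrue a s p k s' q)
  from IfTrue.prems IfTrue.hyps obtain k1 where "exec w S p s k1 s''" "l = Suc k1"
    by (cases rule: exec.cases) simp_all
  with IfTrue.IH show ?case by metis
next
  case (IfFalse a s q k s' p)
  from IfFalse.prems IfFalse.hyps obtain k1 where "exec w S q s k1 s''" "l = Suc k1"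
    by (cases rule: exec.cases) simp_all
  with IfFalse.IH show ?case by metis
next
  case (WhileFalse a s p)
  from WhileFalse.prems WhileFalse.hyps show ?case
    by (cases rule: exec.cases) simp_all
next
  case (WhileTrue a s p k s' l' t)
  from WhileTrue.prems WhileTrue.hyps obtain k1 s1 l1
    where "exec w S p s k1 s1" "exec w S (WhileNZ a p) s1 l1 s''" "l = Suc (k1 + l1)"
    by (cases rule: exec.cases) simp_all
  with WhileTrue.IH show ?case by metis
next
  case Skip
  from Skip.prems show ?case by (cases rule: exec.cases) simp_all
next
  case SetConst
  from SetConst.prems show ?case by (cases rule: exec.cases) simp_all
next
  case Op
  from Op.prems show ?case by (cases rule: exec.cases) simp_all
next
  case Load
  from Load.prems show ?case by (cases rule: exec.cases) simp_all
next
  case Store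
  from Store.prems show ?case by (cases rule: exec.cases) simp_all
next
  case Flip
  from Flip.prems show ?case by (cases rule: exec.cases) simp_all
qed


subsection \<open>Running a program on a stream\<close>

text \<open>Interface cells: cell 0 initially contains \<open>n\<close>, all other cells contain 0. Before each
  update, its kind (1 for an insertion, 0 for a deletion) and the two end points are written to
  cells 1, 2, 3, and then the program is executed. Afterwards the maintained edge set must be
  present in memory as a contiguous list of pairs of end points, with its length in cell 4 and
  its start address in cell 5; the order and repetitions are immaterial.\<close>

definition initial_state :: "nat \<Rightarrow> bool stream \<Rightarrow> state" where
  "initial_state n \<omega> = ((\<lambda>_. 0)(0 := n), \<omega>)"

fun feed :: "update \<Rightarrow> state \<Rightarrow> state" where
  "feed (Insert u v) (m, \<omega>) = (m(1 := 1, 2 := u, 3 := v), \<omega>)"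
| "feed (Delete u v) (m, \<omega>) = (m(1 := 0, 2 := u, 3 := v), \<omega>)"

definition stored_edges :: "state \<Rightarrow> nat set set" where
  "stored_edges s = (let m = fst s in
     {{m (m 5 + 2 * i), m (m 5 + 2 * i + 1)} | i. i < m 4})"

definition stored_within :: "nat \<Rightarrow> state \<Rightarrow> bool" where
  "stored_within S s \<longleftrightarrow> (let m = fst s in m 5 + 2 * m 4 \<le> S)"

text \<open>\<open>st t\<close> is the state after \<open>t\<close> updates; every update takes at most \<open>\<tau>\<close> steps.\<close>

definition is_run ::
  "nat \<Rightarrow> nat \<Rightarrow> nat \<Rightarrow> prog \<Rightarrow> nat \<Rightarrow> nat \<Rightarrow> (nat \<Rightarrow> update) \<Rightarrow> bool stream \<Rightarrow> (nat \<Rightarrow> state) \<Rightarrow> bool"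
where
  "is_run w S \<tau> p n T upd \<omega> st \<longleftrightarrow>
     st 0 = initial_state n \<omega> \<and>
     (\<forall>t<T. \<exists>k\<le>\<tau>. exec w S p (feed (upd t) (st t)) k (st (Suc t)))"

definition coins :: "bool stream measure" where
  "coins = stream_space (measure_pmf (bernoulli_pmf (1 / 2)))"


subsection \<open>Asymptotics\<close>

text \<open>\<open>f \<in> soft_O g\<close> says that $f(\epsilon, n) = \tilde O(g(n))$: the constants do not depend on
  \<open>\<epsilon>\<close>, and factors polynomial in $\log n$ and $1/\epsilon$ are suppressed.\<close>

definition soft_O :: "(nat \<Rightarrow> real) \<Rightarrow> (real \<Rightarrow> nat \<Rightarrow> nat) set" where
  "soft_O g = {f. \<exists>(C::real) (a::nat) (b::nat). \<forall>\<epsilon>. 0 < \<epsilon> \<longrightarrow> \<epsilon> < 1 \<longrightarrow> (\<forall>n\<ge>2.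
     real (f \<epsilon> n) \<le> C * g n * log 2 (real n) ^ a * (1 / \<epsilon>) ^ b)}"

definition word_length :: "nat \<Rightarrow> nat \<Rightarrow> nat" where
  "word_length \<kappa> n = \<kappa> * nat \<lceil>log 2 (real n)\<rceil>"

end

theory Submission
  imports Defs "HOL-Library.Log_Nat"
begin

text \<open>Every edge \<open>{u, v}\<close> gets an identifier, and the identifiers are hashed into \<open>B = O(n log\<^sup>2 n)\<close>
  buckets, in \<open>L = O(log n)\<close> independent repetitions. Each bucket stores how many edges it contains and
  the sum of their identifiers. If the number is 1, the sum is the identifier of the only edge, so what
  is decoded is correct for every outcome of the coins; these isolated edges form the output. As
  \<open>B\<close> is at least twice the number of edges, an edge is not isolated in one repetition with
  probability at most \<open>1/2\<close>, hence in none with probability at most \<open>1 / 2 ^ L\<close>, and a union bound over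
  all edges and all time steps concludes. Bit number \<open>k\<close> of a hash value is the inner product
  modulo 2 of the identifier with fresh coins: flipping the coin at a position where two identifiers
  differ changes whether they agree in bit \<open>k\<close>, which makes the family universal.\<close>

subsection \<open>Weakest preconditions\<close>

text \<open>The difficulty lies in the worst-case time, since the output must lie in memory as a
  contiguous list after every update. Each list entry therefore remembers the bucket that owns it
  and each bucket its list position, so that an entry can be deleted in constant time by moving the
  last one into its place. An edge isolated in several repetitions is listed several times, which
  the interface permits. There is no time to clear the \<open>R\<close> buckets. The coins are kept,
  because a deletion must find the buckets of the earlier insertion. Running time, space and absence
  of overflow hold for every outcome of the coins; chance enters only through which edges are
  isolated. That depends on the first \<open>K\<close> coins alone, so all probabilities reduce to
  counting bit lists of length \<open>K\<close>. Powers of two for \<open>N\<close> and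
  \<open>B\<close> are found by doubling, and they match the number of bits of an identifier and of
  a hash value exactly.\<close>

definition wp :: "nat \<Rightarrow> nat \<Rightarrow> prog \<Rightarrow> (nat \<Rightarrow> (nat \<Rightarrow> nat) \<Rightarrow> bool stream \<Rightarrow> bool) \<Rightarrow>
    (nat \<Rightarrow> nat) \<Rightarrow> bool stream \<Rightarrow> bool" where
  "wp w S p Q m \<omega> \<longleftrightarrow> (\<exists>k m' \<omega>'. exec w S p (m, \<omega>) k (m', \<omega>') \<and> Q k m' \<omega>')"

lemma wp_Skip: "wp w S Skip Q m \<omega> \<longleftrightarrow> Q 1 m \<omega>"
  unfolding wp_def by (auto simp: exec.simps[of _ _ "Skip"])

lemma wp_SetConst:
  "wp w S (SetConst a x) Q m \<omega> \<longleftrightarrow> a < S \<and> x < 2 ^ w \<and> Q 1 (m(a := x)) \<omega>"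
  unfolding wp_def by (auto simp: exec.simps[of _ _ "SetConst a x"])

lemma wp_Op:
  "wp w S (Op f a b c) Q m \<omega> \<longleftrightarrow> a < S \<and> b < S \<and> c < S \<and>
     binop_val f (m b) (m c) < 2 ^ w \<and> Q 1 (m(a := binop_val f (m b) (m c))) \<omega>"
  unfolding wp_def by (auto simp: exec.simps[of _ _ "Op f a b c"])

lemma wp_Load:
  "wp w S (Load a b) Q m \<omega> \<longleftrightarrow> a < S \<and> b < S \<and> m b < S \<and> Q 1 (m(a := m (m b))) \<omega>"
  unfolding wp_def by (auto simp: exec.simps[of _ _ "Load a b"])

lemma wp_Store:
  "wp w S (Store a b) Q m \<omega> \<longleftrightarrow> a < S \<and> b < S \<and> m a < S \<and> Q 1 (m(m a := m b)) \<omega>"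
  unfolding wp_def by (auto simp: exec.simps[of _ _ "Store a b"])

lemma wp_Flip:
  "wp w S (Flip a) Q m \<omega> \<longleftrightarrow> a < S \<and> Q 1 (m(a := of_bool (shd \<omega>))) (stl \<omega>)"
  unfolding wp_def by (auto simp: exec.simps[of _ _ "Flip a"])

lemma wp_Seq:
  "wp w S (Seq p q) Q m \<omega> \<longleftrightarrow>
     wp w S p (\<lambda>k m' \<omega>'. wp w S q (\<lambda>l. Q (k + l)) m' \<omega>') m \<omega>"
  (is "?l \<longleftrightarrow> ?r")
proof
  assume ?l
  then obtain k m' \<omega>' where "exec w S (Seq p q) (m, \<omega>) k (m', \<omega>')" "Q k m' \<omega>'"
    unfolding wp_def by blast
  then show ?r unfolding wp_def by cases (metis surj_pair)
next
  assume ?r then show ?l unfolding wp_def by (blast intro: exec.intros)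
qed

lemma wp_IfNZ:
  "wp w S (IfNZ a p q) Q m \<omega> \<longleftrightarrow> a < S \<and>
     (if m a \<noteq> 0 then wp w S p (\<lambda>k. Q (Suc k)) m \<omega> else wp w S q (\<lambda>k. Q (Suc k)) m \<omega>)"
  (is "?l \<longleftrightarrow> ?r")
proof
  assume ?l
  then obtain k m' \<omega>' where "exec w S (IfNZ a p q) (m, \<omega>) k (m', \<omega>')" "Q k m' \<omega>'"
    unfolding wp_def by blast
  then show ?r unfolding wp_def by cases auto
next
  assume ?r then show ?l
    unfolding wp_def by (auto split: if_splits intro!: exec.intros) (fastforce intro: exec.intros)+
qed

lemmas wp_simps = wp_Skip wp_SetConst wp_Op wp_Load wp_Store wp_Flip wp_Seq wp_IfNZ

lemma wp_mono:
  assumes "wp w S p Q m \<omega>" "\<And>k m' \<omega>'. Q k m' \<omega>' \<Longrightarrow> Q' k m' \<omega>'"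
  shows "wp w S p Q' m \<omega>"
  using assms unfolding wp_def by blast

text \<open>Total correctness with a time bound: the invariant is indexed by the number of completed
  rounds, and exactly \<open>r\<close> rounds take place. The induction is on the number of
  remaining rounds. The extra 1 per round, and the 1 at the end, pay for the loop tests.\<close>

lemma wp_WhileNZ:
  assumes "a < S" "I 0 m \<omega>"
    and "\<And>i m \<omega>. i < r \<Longrightarrow> I i m \<omega> \<Longrightarrow>
           m a \<noteq> 0 \<and> wp w S p (\<lambda>k m' \<omega>'. k \<le> c \<and> I (Suc i) m' \<omega>') m \<omega>"
    and "\<And>m \<omega>. I r m \<omega> \<Longrightarrow> m a = 0"
  shows "wp w S (WhileNZ a p) (\<lambda>k m' \<omega>'. k \<le> r * (c + 1) + 1 \<and> I r m' \<omega>') m \<omega>"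
proof -
  have "i \<le> r \<Longrightarrow> I i m \<omega> \<Longrightarrow>
    wp w S (WhileNZ a p) (\<lambda>k m' \<omega>'. k \<le> (r - i) * (c + 1) + 1 \<and> I r m' \<omega>') m \<omega>" for i m \<omega>
  proof (induction "r - i" arbitrary: i m \<omega>)
    case 0
    then have "i = r" by simp
    with 0 assms(1,4) have "exec w S (WhileNZ a p) (m, \<omega>) 1 (m, \<omega>)"
      by (intro exec.WhileFalse) auto
    with 0 \<open>i = r\<close> show ?case unfolding wp_def by auto
  next
    case (Suc d)
    then have "i < r" by simp
    with Suc.prems assms(3)[of i m \<omega>] obtain k m' \<omega>' where 1: "m a \<noteq> 0"
      "exec w S p (m, \<omega>) k (m', \<omega>')" "k \<le> c" "I (Suc i) m' \<omega>'"
      unfolding wp_def by blast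
    from Suc.hyps(1)[of "Suc i" m' \<omega>'] 1(4) Suc.hyps(2) \<open>i < r\<close>
    obtain l m'' \<omega>'' where 2: "exec w S (WhileNZ a p) (m', \<omega>') l (m'', \<omega>'')"
      "l \<le> (r - Suc i) * (c + 1) + 1" "I r m'' \<omega>''"
      unfolding wp_def by fastforce
    have "exec w S (WhileNZ a p) (m, \<omega>) (Suc (k + l)) (m'', \<omega>'')"
      using assms(1) 1 2 by (intro exec.WhileTrue) auto
    moreover have "r - i = Suc (r - Suc i)" using \<open>i < r\<close> by simp
    then have "Suc (k + l) \<le> (r - i) * (c + 1) + 1" using 1(3) 2(2) by simp
    ultimately show ?case using 2(3) unfolding wp_def by blast
  qed
  from this[of 0 m \<omega>] assms(2) show ?thesis by simp
qed

fun block :: "prog list \<Rightarrow> prog" where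
  "block [] = Skip"
| "block (p # ps) = Seq p (block ps)"

lemma wp_block:
  "wp w S (block []) Q m \<omega> \<longleftrightarrow> Q 1 m \<omega>"
  "wp w S (block (p # ps)) Q m \<omega> \<longleftrightarrow>
     wp w S p (\<lambda>k m' \<omega>'. wp w S (block ps) (\<lambda>l. Q (k + l)) m' \<omega>') m \<omega>"
  by (simp_all add: wp_Skip wp_Seq)

lemma wp_Seq_Skip: "(\<lambda>k. wp w S Skip (\<lambda>l. Q (k + l))) = (\<lambda>k. Q (Suc k))"
  by (simp add: fun_eq_iff wp_Skip)

text \<open>As a congruence rule this confines the simplifier to the memory, so that a straight-line
  program is executed step by step; without it the postcondition, which contains the rest of the
  program, would be simplified first, for an unknown memory.\<close>

lemma wp_cong:
  "m = m' \<Longrightarrow> \<omega> = \<omega>' \<Longrightarrow> wp w S p Q m \<omega> = wp w S p Q m' \<omega>'"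
  by simp

subsection \<open>Updating one bucket\<close>

text \<open>Use of the memory: cells 7 and 8 hold the constants 1 and 2; 9 holds \<open>N\<close>, a power of two with
  \<open>n \<le> N\<close>; 11 the number of buckets per repetition; 12 its logarithm; 13 the number of repetitions;
  14 the number of bits of an identifier; 17 to 20 the start addresses of the counters, of the
  sums, of the list positions of the buckets, and of the buckets that own the list entries; 21
  the identifier of the updated edge. Cells 22 to 37 are scratch.\<close>

definition if_one :: "prog \<Rightarrow> prog" where
  "if_one p = IfNZ 30 (block [Op Sub 35 30 7, IfNZ 35 Skip p]) Skip"

text \<open>The last list entry is moved to the place of the removed one.\<close>

definition remove_prog :: prog where
  "remove_prog = block [Load 29 34, Op Sub 4 4 7, Op Add 35 20 4, Load 36 35,
     Op Add 35 20 29, Store 35 36, Op Add 35 19 36, Store 35 29,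
     Op Add 28 29 29, Op Add 28 28 5, Op Add 35 4 4, Op Add 35 35 5,
     Load 30 35, Store 28 30, Op Add 35 35 7, Op Add 28 28 7, Load 30 35, Store 28 30]"

definition append_prog :: prog where
  "append_prog = block [Op Add 35 20 4, Store 35 31, Store 34 4, Op Add 35 4 4, Op Add 35 35 5,
     Op Div 30 37 9, Store 35 30, Op Add 35 35 7, Op Mod 30 37 9, Store 35 30, Op Add 4 4 7]"

definition change_prog :: prog where
  "change_prog = block [Load 30 32, Load 37 33,
     IfNZ 1 (block [Op Add 30 30 7, Op Add 37 37 21]) (block [Op Sub 30 30 7, Op Sub 37 37 21]),
     Store 32 30, Store 33 37]"

text \<open>The list entry of the bucket is removed while its old content is still valid, and a new
  one is appended after the change. The transitions between 0 and 1 and between 1 and 2 edges thus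
  need no separate treatment.\<close>

definition bucket_prog :: prog where
  "bucket_prog = block [Op Add 31 22 25, Op Add 32 17 31, Op Add 33 18 31, Op Add 34 19 31,
     Load 30 32, if_one remove_prog, change_prog, if_one append_prog]"

lemma swap_delete:
  assumes "distinct xs" "i < length xs"
  shows "distinct (butlast (xs[i := last xs]))"
    and "set (butlast (xs[i := last xs])) = set xs - {xs ! i}"
proof -
  obtain ys z where xs: "xs = ys @ [z]" using assms(2) by (cases xs rule: rev_cases) auto
  have "distinct (butlast (xs[i := last xs])) \<and>
      set (butlast (xs[i := last xs])) = set xs - {xs ! i}"
  proof (cases "i < length ys")
    case True
    then show ?thesis using assms xs
      by (auto simp: list_update_append nth_append set_update_distinct intro!: distinct_list_update)
  next
    case False
    then have "i = length ys" using assms xs by simp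
    then show ?thesis using assms xs by auto
  qed
  then show "distinct (butlast (xs[i := last xs]))"
    "set (butlast (xs[i := last xs])) = set xs - {xs ! i}" by auto
qed

section \<open>Memory layout and the invariant of a bucket update\<close>

locale layout =
  fixes w S N B ell L bits K R :: nat
  assumes S_eq: "S = 64 + K + 6 * R" and S_w: "S + 64 \<le> 2 ^ w"
    and N_w: "N * N * (N * N) < 2 ^ w" and N_pos: "N > 0"
begin

lemma reg_lt_S [simp]: "a < 64 \<Longrightarrow> a < S"
  by (simp add: S_eq)

lemma lt_S: "a < 64 + K + 6 * R \<Longrightarrow> a < S"
  by (simp add: S_eq)

lemma lt_S_w: "x < 64 + K + 6 * R \<Longrightarrow> x < 2 ^ w"
  using S_w by (simp add: S_eq)

definition regs :: "(nat \<Rightarrow> nat) \<Rightarrow> bool" where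
  "regs m \<longleftrightarrow> m 5 = 64 + K + 4 * R \<and> m 7 = 1 \<and> m 8 = 2 \<and> m 9 = N \<and> m 11 = B \<and> m 12 = ell \<and>
     m 13 = L \<and> m 14 = bits \<and> m 17 = 64 + K \<and> m 18 = 64 + K + R \<and> m 19 = 64 + K + 2 * R \<and>
     m 20 = 64 + K + 3 * R"

text \<open>Only registers and stored coins are compared; the cells from \<open>64 + K\<close> on
  are governed by \<open>table\<close> instead.\<close>

definition agree_except :: "nat set \<Rightarrow> (nat \<Rightarrow> nat) \<Rightarrow> (nat \<Rightarrow> nat) \<Rightarrow> bool" where
  "agree_except X m m' \<longleftrightarrow> (\<forall>a<64 + K. a \<notin> X \<longrightarrow> m' a = m a)"

text \<open>\<open>D q\<close> is the set of identifiers in bucket \<open>q\<close>, and \<open>os\<close> lists the buckets that own the entries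
  of the output list. The cells from \<open>64 + K\<close> on are divided into six blocks of length \<open>R\<close>, of
  which the last two contain the output list.\<close>

definition table :: "(nat \<Rightarrow> nat set) \<Rightarrow> nat list \<Rightarrow> (nat \<Rightarrow> nat) \<Rightarrow> bool" where
  "table D os m \<longleftrightarrow>
     (\<forall>q<R. D q \<subseteq> {..<N * N} \<and> m (64 + K + q) = card (D q) \<and> m (64 + K + R + q) = \<Sum>(D q)) \<and>
     m 4 = length os \<and> distinct os \<and> set os \<subseteq> {..<R} \<and>
     (\<forall>i<length os. m (64 + K + 2 * R + os ! i) = i \<and> m (64 + K + 3 * R + i) = os ! i \<and>
        m (64 + K + 4 * R + 2 * i) = \<Sum>(D (os ! i)) div N \<and>
        m (Suc (64 + K + 4 * R + 2 * i)) = \<Sum>(D (os ! i)) mod N)"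

lemma table_length: "table D os m \<Longrightarrow> length os \<le> R"
  unfolding table_def by (metis card_lessThan card_mono distinct_card finite_lessThan)

lemma agree_except_regs:
  assumes "agree_except X m m'" "X \<subseteq> {1, 2, 3, 4} \<union> {21..<64}" "regs m"
  shows "regs m'"
proof -
  have "a \<notin> X" if "4 < a" "a < 21" for a using assms(2) that by auto
  with assms(1) have "m' a = m a" if "4 < a" "a < 21" for a
    using that unfolding agree_except_def by simp
  with assms(3) show ?thesis unfolding regs_def by simp
qed

lemma agree_except_trans: "agree_except X m m' \<Longrightarrow> agree_except Y m' m'' \<Longrightarrow> X \<union> Y \<subseteq> Z \<Longrightarrow> agree_except Z m m''"
  unfolding agree_except_def by (metis Un_iff subsetD)

lemma table_bucket:
  assumes "table D os m" "q < R"
  shows "m (64 + K + q) = card (D q)" "m (64 + K + R + q) = \<Sum>(D q)" "D q \<subseteq> {..<N * N}"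
  using assms by (auto simp: table_def)

lemma table_list:
  assumes "table D os m" "j < length os"
  shows "m (64 + K + 2 * R + os ! j) = j" "m (64 + K + 3 * R + j) = os ! j"
    "m (2 * j + (64 + (K + 4 * R))) = \<Sum>(D (os ! j)) div N"
    "m (65 + (2 * j + (K + 4 * R))) = \<Sum>(D (os ! j)) mod N"
    "os ! j < R"
proof -
  have e: "2 * j + (64 + (K + 4 * R)) = 64 + K + 4 * R + 2 * j"
    "65 + (2 * j + (K + 4 * R)) = Suc (64 + K + 4 * R + 2 * j)" by auto
  show "m (2 * j + (64 + (K + 4 * R))) = \<Sum>(D (os ! j)) div N"
    "m (65 + (2 * j + (K + 4 * R))) = \<Sum>(D (os ! j)) mod N"
    unfolding e using assms by (simp_all add: table_def)
  show "m (64 + K + 2 * R + os ! j) = j" "m (64 + K + 3 * R + j) = os ! j" "os ! j < R"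
    using assms nth_mem[of j os] by (auto simp: table_def subset_iff)
qed

text \<open>The origin of the assumption \<open>N_w\<close>: a bucket contains at most
  \<open>N * N\<close> identifiers, each below \<open>N * N\<close>, so its sum never overflows a
  word.\<close>

lemma sum_bounds:
  fixes X :: "nat set"
  assumes "X \<subseteq> {..<N * N}"
  shows "card X \<le> N * N" "\<Sum>X \<le> N * N * (N * N)" "card X < 2 ^ w" "\<Sum>X < 2 ^ w"
proof -
  show c: "card X \<le> N * N" using card_mono[OF _ assms] by simp
  have "\<Sum>X \<le> (\<Sum>x\<in>X. N * N)" using assms by (intro sum_mono) auto
  also have "\<dots> \<le> N * N * (N * N)" using c by simp
  finally show s: "\<Sum>X \<le> N * N * (N * N)" .
  show "\<Sum>X < 2 ^ w" using s N_w by simp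
  have "N * N \<le> N * N * (N * N)" using N_pos by simp
  with c N_w show "card X < 2 ^ w" by linarith
qed

lemma wp_remove:
  assumes m: "regs m" "table D os m" and q: "q \<in> set os" "m 34 = 64 + K + 2 * R + q"
  shows "wp w S remove_prog (\<lambda>k m' \<omega>'. k \<le> 19 \<and> agree_except {4, 28, 29, 30, 35, 36} m m' \<and>
    (\<exists>os'. table D os' m' \<and> set os' = set os - {q})) m \<omega>"
proof -
  obtain i where i: "i < length os" "os ! i = q" using q by (metis in_set_conv_nth)
  define l where "l = length os - 1"
  define r where "r = os ! l"
  have l: "length os = Suc l" "l < R" "i \<le> l" using table_length[OF m(2)] i by (auto simp: l_def)
  have qR: "q < R" "r < R" using m(2) q(1) l nth_mem[of l os]
    by (auto simp: table_def r_def subset_iff)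
  have t: "m (64 + K + 2 * R + q) = i" "m (64 + K + 3 * R + l) = r" "m 4 = Suc l"
    using m(2) i l by (auto simp: table_def r_def)
  define os' where "os' = butlast (os[i := last os])"
  have dist: "distinct os" using m(2) by (simp add: table_def)
  have r: "last os = r" using l by (simp add: r_def last_conv_nth flip: length_0_conv)
  have os': "length os' = l" "\<And>j. j < l \<Longrightarrow> os' ! j = (if j = i then r else os ! j)"
    "distinct os'" "set os' = set os - {q}"
    using l swap_delete[OF dist i(1)] i(2)
    by (auto simp: os'_def nth_butlast nth_list_update r)
  \<comment> \<open>Redirecting the position of the owner \<open>r\<close> of the last entry affects
    no other entry, because owners are distinct.\<close>
  have inj: "os ! j = r \<longleftrightarrow> j = l" if "j \<le> l" for j
    using that l dist by (auto simp: r_def nth_eq_iff_index_eq)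
  \<comment> \<open>The memory at the end. If the removed entry is itself the last one, the owner,
    the position and the pair are overwritten by their own values, so the program needs no case
    distinction.\<close>
  let ?m = "m(29 := i, 4 := l, 36 := r, 64 + K + 3 * R + i := r,
               64 + K + 2 * R + r := i,
               2 * i + (64 + (K + 4 * R)) := m (2 * l + (64 + (K + 4 * R))),
               35 := 65 + (2 * l + (K + 4 * R)),
               28 := 65 + (2 * i + (K + 4 * R)),
               30 := m (65 + (2 * l + (K + 4 * R))),
               65 + (2 * i + (K + 4 * R)) :=
                 m (65 + (2 * l + (K + 4 * R))))"
  have old': "m (64 + K + 2 * R + os ! j) = j" "m (64 + K + 3 * R + j) = os ! j"
        "m (2 * j + (64 + (K + 4 * R))) = \<Sum>(D (os ! j)) div N"
        "m (65 + (2 * j + (K + 4 * R))) = \<Sum>(D (os ! j)) mod N" "os ! j < R" if "j \<le> l" for j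
    using table_list[OF m(2), of j] that l by simp_all
  have osR: "j \<le> l \<longrightarrow> os ! j < R" for j using old'(5) by blast
  have "table D os' ?m"
    unfolding table_def
    apply (intro conjI allI impI)
    subgoal using table_bucket(3)[OF m(2)] .
    subgoal for j using table_bucket[OF m(2), of j] l qR by simp
    subgoal for j using table_bucket[OF m(2), of j] l qR by simp
    subgoal using l os' by simp
    subgoal using os' by simp
    subgoal using os' m(2) by (auto simp: table_def)
    subgoal for j using l qR os' old'(1-4) osR[of j] inj[of j] by (cases "j = i") auto
    subgoal for j using l qR os' old'(1-4) osR[of j] inj[of j] by (cases "j = i") auto
    subgoal for j using l qR os' old'[of j] old'[of l] osR[of j] inj[of j] r_def
      by (cases "j = i") (auto simp: ac_simps)
    subgoal for j using l qR os' old'[of j] old'[of l] osR[of j] inj[of j] r_def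
      by (cases "j = i") (auto simp: ac_simps)
    done
  moreover have "agree_except {4, 28, 29, 30, 35, 36} m ?m" by (simp add: agree_except_def)
  ultimately show ?thesis
    unfolding remove_prog_def
    using l qR os'(4)
    by (simp add: S_eq lt_S_w wp_simps wp_block m(1)[unfolded regs_def] q(2) t cong: wp_cong) blast
qed

lemma wp_append:
  assumes m: "regs m" "table D os m" and q: "q \<notin> set os" "q < R" "m 31 = q"
    "m 34 = 64 + K + 2 * R + q" "m 37 = \<Sum>(D q)"
  shows "wp w S append_prog (\<lambda>k m' \<omega>'. k \<le> 12 \<and> agree_except {4, 30, 35} m m' \<and>
    (\<exists>os'. table D os' m' \<and> set os' = insert q (set os))) m \<omega>"
proof -
  define l where "l = length os"
  \<comment> \<open>A slot is free: together with \<open>q\<close>, the owners on the list are still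
    distinct buckets below \<open>R\<close>.\<close>
  have "insert q (set os) \<subseteq> {..<R}" using m(2) q by (auto simp: table_def)
  then have "card (insert q (set os)) \<le> card {..<R}" by (intro card_mono) auto
  then have l: "length os = l" "l < R" "m 4 = l"
    using m(2) q by (auto simp: l_def table_def distinct_card)
  have D: "\<Sum>(D q) div N < 2 ^ w" "\<Sum>(D q) mod N < 2 ^ w"
    using sum_bounds[OF table_bucket(3)[OF m(2) q(2)]]
    by (meson div_le_dividend mod_less_eq_dividend le_less_trans)+
  let ?m = "m(64 + K + 3 * R + l := q, 64 + K + 2 * R + q := l,
           2 * l + (64 + (K + 4 * R)) := \<Sum> (D q) div N,
           35 := 65 + (2 * l + (K + 4 * R)), 30 := \<Sum> (D q) mod N,
           65 + (2 * l + (K + 4 * R)) := \<Sum> (D q) mod N, 4 := Suc l)"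
  have q': "os ! j \<noteq> q" if "j < l" for j using that q(1) l by auto
  have list: "m (64 + K + 2 * R + os ! j) = j" "m (64 + K + 3 * R + j) = os ! j"
        "m (2 * j + (64 + (K + 4 * R))) = \<Sum>(D (os ! j)) div N"
        "m (65 + (2 * j + (K + 4 * R))) = \<Sum>(D (os ! j)) mod N" "os ! j < R" if "j < l" for j
    using table_list[OF m(2), of j] that l by simp_all
  have osR: "j < l \<longrightarrow> os ! j < R" for j using list(5) by blast
  have nth: "(os @ [q]) ! j = (if j = l then q else os ! j)" if "j < Suc l" for j
    using that l by (auto simp: nth_append)
  have "table D (os @ [q]) ?m"
    unfolding table_def
    apply (intro conjI allI impI)
    subgoal using table_bucket(3)[OF m(2)] .
    subgoal for j using table_bucket[OF m(2), of j] l q by simp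
    subgoal for j using table_bucket[OF m(2), of j] l q by simp
    subgoal using l by simp
    subgoal using q m(2) by (simp add: table_def)
    subgoal using m(2) q by (auto simp: table_def)
    subgoal for j using l q nth[of j] list(1-4) osR[of j] q'[of j] by (cases "j = l") auto
    subgoal for j using l q nth[of j] list(1-4) osR[of j] q'[of j] by (cases "j = l") auto
    subgoal for j using l q nth[of j] list[of j] q'[of j] by (cases "j = l") (auto simp: ac_simps)
    subgoal for j using l q nth[of j] list[of j] q'[of j] by (cases "j = l") (auto simp: ac_simps)
    done
  moreover have "set (os @ [q]) = insert q (set os)" by simp
  ultimately have "\<exists>os'. table D os' ?m \<and> set os' = insert q (set os)" by blast
  moreover have "agree_except {4, 30, 35} m ?m" by (simp add: agree_except_def)
  ultimately show ?thesis
    unfolding append_prog_def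
    using l q(2)
    by (simp add: S_eq lt_S_w wp_simps wp_block m(1)[unfolded regs_def] q(3-) l(3) D cong: wp_cong)
qed

text \<open>The list survives a change of the sum of bucket \<open>q\<close> because
  \<open>q\<close> owns no entry at this moment. Cells 30 and 37 hand the new number and the new sum
  on to the test and to \<open>append_prog\<close>.\<close>

lemma wp_change:
  assumes m: "regs m" "table D os m" and q: "q \<notin> set os" "q < R" "m 32 = 64 + K + q"
    "m 33 = 64 + K + R + q" and x: "m 21 = x" "x < N * N"
    and D': "if m 1 = 0 then x \<in> D q \<and> D' = D q - {x} else x \<notin> D q \<and> D' = insert x (D q)"
  shows "wp w S change_prog (\<lambda>k m' \<omega>'. k \<le> 10 \<and> agree_except {30, 37} m m' \<and>
    table (D(q := D')) os m' \<and> m' 30 = card D' \<and> m' 37 = \<Sum>D') m \<omega>"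
proof -
  have D'N: "D' \<subseteq> {..<N * N}" and fin: "finite (D q)"
    using table_bucket(3)[OF m(2) q(2)] x(2) D' finite_subset by (auto split: if_splits)
  have c: "m 1 = 0 \<Longrightarrow> card (D q) - Suc 0 = card D' \<and> \<Sum>(D q) - x = \<Sum>D'"
     "m 1 \<noteq> 0 \<Longrightarrow> Suc (card (D q)) = card D' \<and> \<Sum>(D q) + x = \<Sum>D'"
    using D' fin by (auto simp: sum_diff1_nat card_insert_if add.commute)
  let ?m = "m(30 := card D', 37 := \<Sum> D', 64 + K + q := card D', 64 + K + R + q := \<Sum> D')"
  have q': "os ! j \<noteq> q" if "j < length os" for j using that q(1) by auto
  have "length os \<le> R" by (rule table_length[OF m(2)])
  have "table (D(q := D')) os ?m"
    unfolding table_def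
    apply (intro conjI allI impI)
    subgoal using table_bucket(3)[OF m(2)] D'N by simp
    subgoal for j using table_bucket[OF m(2), of j] q(2) by simp
    subgoal for j using table_bucket[OF m(2), of j] q(2) by simp
    subgoal using m(2) by (simp add: table_def)
    subgoal using m(2) by (simp add: table_def)
    subgoal using m(2) by (simp add: table_def)
    subgoal for j using \<open>length os \<le> R\<close> q(2) table_list[OF m(2), of j] q'[of j] by auto
    subgoal for j using \<open>length os \<le> R\<close> q(2) table_list[OF m(2), of j] q'[of j] by auto
    subgoal for j using \<open>length os \<le> R\<close> q(2) table_list[OF m(2), of j] q'[of j] by (auto simp: ac_simps)
    subgoal for j using \<open>length os \<le> R\<close> q(2) table_list[OF m(2), of j] q'[of j] by (auto simp: ac_simps)
    done
  moreover have "agree_except {30, 37} m ?m" by (simp add: agree_except_def)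
  ultimately show ?thesis
    unfolding change_prog_def
    using q(2) c sum_bounds[OF D'N]
    by (cases "m 1 = 0") (simp_all add: S_eq lt_S_w wp_simps wp_block m(1)[unfolded regs_def] q(3-)
        x table_bucket[OF m(2)] cong: wp_cong)
qed

lemma wp_if_one:
  assumes "m 7 = 1" "m 30 < 2 ^ w"
  shows "wp w S (if_one p) Q m \<omega> \<longleftrightarrow>
     (if m 30 = 1 then wp w S p (\<lambda>k m' \<omega>'. Q (k + 4) m' \<omega>') (m(35 := 0)) \<omega>
      else if m 30 = 0 then Q 2 m \<omega> else Q 5 (m(35 := m 30 - 1)) \<omega>)"
proof -
  have "wp w S p (\<lambda>k. wp w S Skip (\<lambda>l. Q (Suc (Suc (Suc (k + l)))))) m' \<omega>' =
      wp w S p (\<lambda>k. Q (k + 4)) m' \<omega>'" for m' \<omega>'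
    using wp_Seq_Skip[of w S "\<lambda>k. Q (Suc (Suc (Suc k)))"] by (simp add: eval_nat_numeral)
  then show ?thesis
    unfolding if_one_def using assms
    by (simp add: wp_simps wp_block less_imp_diff_less cong: wp_cong)
       (simp add: numeral_2_eq_2 eval_nat_numeral(3)[of Num.One] numeral_nat)
qed

lemma wp_bucket:
  assumes m: "regs m" "table D os m" and os: "set os = {q. q < R \<and> card (D q) = 1}"
    and q: "m 22 + m 25 = q" "q < R" and x: "m 21 = x" "x < N * N"
    and D': "if m 1 = 0 then x \<in> D q \<and> D' = D q - {x} else x \<notin> D q \<and> D' = insert x (D q)"
  shows "wp w S bucket_prog (\<lambda>k m' \<omega>'. k \<le> 70 \<and> agree_except ({4} \<union> {28..<38}) m m' \<and>
    (\<exists>os'. table (D(q := D')) os' m' \<and> set os' = {r. r < R \<and> card ((D(q := D')) r) = 1})) m \<omega>"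
proof -
  let ?A = "agree_except ({4} \<union> {28..<38})"
  \<comment> \<open>\<open>Q1\<close>, \<open>Q2\<close> and \<open>Q3\<close> are the conditions
    after removal, change and append. In the first two, \<open>q\<close> is off the list whatever
    its content.\<close>
  define Q3 where "Q3 c = (\<lambda>k m' (\<omega>'::bool stream). k \<le> c \<and> ?A m m' \<and>
    (\<exists>os'. table (D(q := D')) os' m' \<and> set os' = {r. r < R \<and> card ((D(q := D')) r) = 1}))" for c :: nat
  define Q2 where "Q2 c = (\<lambda>k m' (\<omega>'::bool stream). k \<le> c \<and> ?A m m' \<and> m' 31 = q \<and>
    m' 34 = 64 + K + 2 * R + q \<and> m' 30 = card D' \<and> m' 37 = \<Sum>D' \<and>
    (\<exists>os'. table (D(q := D')) os' m' \<and> set os' = {r. r < R \<and> r \<noteq> q \<and> card (D r) = 1}))" for c :: nat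
  define Q1 where "Q1 c = (\<lambda>k m' (\<omega>'::bool stream). k \<le> c \<and> ?A m m' \<and> m' 31 = q \<and>
    m' 34 = 64 + K + 2 * R + q \<and> m' 32 = 64 + K + q \<and> m' 33 = 64 + K + R + q \<and>
    (\<exists>os'. table D os' m' \<and> set os' = {r. r < R \<and> r \<noteq> q \<and> card (D r) = 1}))" for c :: nat
  have tr: "?A m m''" if "?A m m'" "agree_except X m' m''" "X \<subseteq> {4} \<union> {28..<38}" for m' m'' X
    using agree_except_trans[OF that(1,2)] that(3) by blast
  have rg: "regs m'" if "?A m m'" for m'
    by (rule agree_except_regs[OF that _ m(1)]) auto
  have D'N: "D' \<subseteq> {..<N * N}"
    using table_bucket(3)[OF m(2) q(2)] x(2) D' by (auto split: if_splits)
  have upd: "regs (m'(35 := v)) = regs m'" "table D'' os' (m'(35 := v)) = table D'' os' m'"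
      "?A m m' \<Longrightarrow> ?A m (m'(35 := v))" for m' v D'' os'
    by (simp_all add: regs_def table_def agree_except_def)
  have 3: "wp w S (if_one append_prog) (Q3 20) m' \<omega>'" if Q2: "Q2 10 k m' \<omega>'" for k m' \<omega>'
  proof -
    from Q2 obtain os' where os': "table (D(q := D')) os' m'"
      "set os' = {r. r < R \<and> r \<noteq> q \<and> card (D r) = 1}" unfolding Q2_def by blast
    from Q2 have r: "regs m'" "?A m m'" and v: "m' 31 = q" "m' 34 = 64 + K + 2 * R + q"
      "m' 30 = card D'" "m' 37 = \<Sum>D'" using rg unfolding Q2_def by blast+
    have r7: "m' 7 = 1" using r(1) unfolding regs_def by blast
    have v30: "m' 30 < 2 ^ w" using sum_bounds(3)[OF D'N] v by simp
    show ?thesis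
    proof (cases "card D' = 1")
      case True
      have s: "insert q (set os') = {r. r < R \<and> card ((D(q := D')) r) = 1}"
        using True os'(2) q(2) by auto
      have "wp w S append_prog (\<lambda>k m'' \<omega>''. k \<le> 12 \<and> agree_except {4, 30, 35} (m'(35 := 0)) m'' \<and>
        (\<exists>os''. table (D(q := D')) os'' m'' \<and> set os'' = insert q (set os'))) (m'(35 := 0)) \<omega>'"
        by (rule wp_append) (use os' q(2) r v in \<open>simp_all add: upd\<close>)
      then have "wp w S append_prog (\<lambda>k. Q3 20 (k + 4)) (m'(35 := 0)) \<omega>'"
      proof (rule wp_mono, goal_cases)
        case (1 k m'' \<omega>'')
        with tr[OF upd(3)[OF r(2)]] show ?case unfolding Q3_def s by auto
      qed
      then show ?thesis unfolding wp_if_one[OF r7 v30] using True v by simp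
    next
      case False
      have "{r. r < R \<and> card ((D(q := D')) r) = 1} = set os'"
        using False os'(2) by auto
      then have "Q3 20 2 m' \<omega>'" "Q3 20 5 (m'(35 := v)) \<omega>'" for v
        using upd(3)[OF r(2)] os' r unfolding Q3_def by (auto simp: upd(2))
      then show ?thesis unfolding wp_if_one[OF r7 v30] using False v by simp
    qed
  qed
  have 2: "wp w S change_prog (Q2 10) m' \<omega>'" if Q1: "Q1 25 k m' \<omega>'" for k m' \<omega>'
  proof -
    from Q1 obtain os' where os': "table D os' m'"
      "set os' = {r. r < R \<and> r \<noteq> q \<and> card (D r) = 1}" unfolding Q1_def by blast
    from Q1 have r: "regs m'" "?A m m'" and v: "m' 31 = q" "m' 34 = 64 + K + 2 * R + q"
      "m' 32 = 64 + K + q" "m' 33 = 64 + K + R + q" using rg unfolding Q1_def by blast+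
    have k: "m' 1 = m 1" "m' 21 = m 21" using r(2) by (auto simp: agree_except_def)
    have "wp w S change_prog (\<lambda>k m'' \<omega>''. k \<le> 10 \<and> agree_except {30, 37} m' m'' \<and>
      table (D(q := D')) os' m'' \<and> m'' 30 = card D' \<and> m'' 37 = \<Sum>D') m' \<omega>'"
      by (rule wp_change[where x = x]) (use os' q(2) r v x k D' in simp_all)
    then show ?thesis
    proof (rule wp_mono, goal_cases)
      case (1 k m'' \<omega>'')
      then have "m'' 31 = m' 31" "m'' 34 = m' 34" by (auto simp: agree_except_def)
      with 1 tr[OF r(2)] v os'(2) show ?case unfolding Q2_def by auto
    qed
  qed
  have 1: "wp w S (if_one remove_prog) (Q1 25) m' \<omega>'"
    if r: "?A m m'" "table D os m'" and v: "m' 31 = q" "m' 34 = 64 + K + 2 * R + q"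
      "m' 32 = 64 + K + q" "m' 33 = 64 + K + R + q" "m' 30 = card (D q)" for m' \<omega>'
  proof -
    have r': "regs m'" using rg r by auto
    have r7: "m' 7 = 1" using r' unfolding regs_def by blast
    have v30: "m' 30 < 2 ^ w" using sum_bounds(3)[OF table_bucket(3)[OF m(2) q(2)]] v by simp
    show ?thesis
    proof (cases "card (D q) = 1")
      case True
      have s: "set os - {q} = {r. r < R \<and> r \<noteq> q \<and> card (D r) = 1}"
        using os by auto
      have "wp w S remove_prog (\<lambda>k m'' \<omega>''. k \<le> 19 \<and> agree_except {4, 28, 29, 30, 35, 36} (m'(35 := 0)) m'' \<and>
        (\<exists>os''. table D os'' m'' \<and> set os'' = set os - {q})) (m'(35 := 0)) \<omega>'"
        by (rule wp_remove) (use os True q(2) r r' v in \<open>simp_all add: upd\<close>)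
      then have "wp w S remove_prog (\<lambda>k. Q1 25 (k + 4)) (m'(35 := 0)) \<omega>'"
      proof (rule wp_mono, goal_cases)
        case (1 k m'' \<omega>'')
        then have "m'' 31 = m' 31" "m'' 34 = m' 34" "m'' 32 = m' 32" "m'' 33 = m' 33"
          by (auto simp: agree_except_def)
        with 1 tr[OF upd(3)[OF r(1)]] v show ?case unfolding Q1_def s by auto
      qed
      then show ?thesis unfolding wp_if_one[OF r7 v30] using True v by simp
    next
      case False
      have "{r. r < R \<and> r \<noteq> q \<and> card (D r) = 1} = set os"
        using False os by auto
      then have "Q1 25 2 m' \<omega>'" "Q1 25 5 (m'(35 := u)) \<omega>'" for u
        using upd(3)[OF r(1)] r v unfolding Q1_def by (auto simp: upd(2))
      then show ?thesis unfolding wp_if_one[OF r7 v30] using False v by simp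
    qed
  qed
  have seq: "wp w S (if_one remove_prog)
      (\<lambda>k. wp w S (block [change_prog, if_one append_prog]) (\<lambda>l. Q3 70 (Suc (Suc (Suc (Suc (Suc (k + l)))))))) m' \<omega>'"
    if "?A m m'" "table D os m'" "m' 31 = q" "m' 34 = 64 + K + 2 * R + q"
      "m' 32 = 64 + K + q" "m' 33 = 64 + K + R + q" "m' 30 = card (D q)" for m' \<omega>'
    unfolding wp_block
  proof (rule wp_mono[OF 1[OF that]], rule wp_mono[OF 2], assumption, rule wp_mono[OF 3], assumption)
    fix k k' k'' m1 m2 m3 \<omega>1 \<omega>2 \<omega>3
    assume "Q1 25 k m1 \<omega>1" "Q2 10 k' m2 \<omega>2" "Q3 20 k'' m3 \<omega>3"
    then show "Q3 70 (Suc (Suc (Suc (Suc (Suc (k + (k' + (k'' + 1)))))))) m3 \<omega>3"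
      unfolding Q1_def Q2_def Q3_def by auto
  qed
  let ?m = "m(31 := q, 32 := 64 + K + q, 33 := 64 + K + R + q, 34 := 64 + K + 2 * R + q,
      30 := card (D q))"
  have A: "?A m ?m" and T: "table D os ?m"
    using m(2) by (simp_all add: agree_except_def table_def)
  have "wp w S bucket_prog (Q3 70) m \<omega>"
    unfolding bucket_prog_def
    using q(2) seq[OF A T, of \<omega>]
    by (simp add: wp_simps wp_block lt_S lt_S_w m(1)[unfolded regs_def] q(1)
      table_bucket[OF m(2) q(2)] del: block.simps cong: wp_cong)
  then show ?thesis unfolding Q3_def .
qed

end

subsection \<open>Hashing and the update loop\<close>

definition parity_prog :: prog where
  "parity_prog = block [SetConst 27 0, Op Add 28 21 27, Op Add 29 14 27,
     WhileNZ 29 (block [Op Mod 35 28 8, Load 30 23, Op Mul 35 35 30, Op Add 27 27 35,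
       Op Div 28 28 8, Op Add 23 23 7, Op Sub 29 29 7]),
     Op Mod 27 27 8]"

definition hash_prog :: prog where
  "hash_prog = block [SetConst 25 0, Op Add 26 12 25,
     WhileNZ 26 (block [parity_prog, Op Mul 25 25 8, Op Add 25 25 27, Op Sub 26 26 7])]"

text \<open>With truncated subtraction, \<open>u - (u - v)\<close> is the minimum and \<open>v + (u - v)\<close> the maximum.\<close>

definition update_prog :: prog where
  "update_prog = block [Op Sub 35 2 3, Op Sub 21 2 35, Op Add 30 3 35, Op Mul 21 21 9,
     Op Add 21 21 30, SetConst 22 0, SetConst 23 64, Op Add 24 13 22,
     WhileNZ 24 (block [hash_prog, bucket_prog, Op Add 22 22 11, Op Sub 24 24 7])]"

definition parity :: "nat \<Rightarrow> (nat \<Rightarrow> nat) \<Rightarrow> nat \<Rightarrow> nat \<Rightarrow> nat" where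
  "parity bits cs p x = (\<Sum>i<bits. (x div 2 ^ i mod 2) * cs (p + i)) mod 2"

text \<open>Every bit has its own window of \<open>bits\<close> coins. Disjointness of the windows
  provides the independence behind the collision count; as they are consecutive, the program only
  has to advance a pointer, cell 23.\<close>

fun hash_value :: "nat \<Rightarrow> (nat \<Rightarrow> nat) \<Rightarrow> nat \<Rightarrow> nat \<Rightarrow> nat \<Rightarrow> nat" where
  "hash_value bits cs p x 0 = 0"
| "hash_value bits cs p x (Suc k) = 2 * hash_value bits cs p x k + parity bits cs (p + k * bits) x"

lemma hash_value_less: "hash_value bits cs p x k < 2 ^ k"
proof (induction k)
  case (Suc k)
  have "parity bits cs (p + k * bits) x \<le> 1" unfolding parity_def by simp
  with Suc show ?case by simp
qed simp

text \<open>In contrast to \<open>agree_except\<close> this includes the table, for programs whose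
  effect on all of memory is known.\<close>

definition same_except :: "nat set \<Rightarrow> (nat \<Rightarrow> nat) \<Rightarrow> (nat \<Rightarrow> nat) \<Rightarrow> bool" where
  "same_except X m m' \<longleftrightarrow> (\<forall>a. a \<notin> X \<longrightarrow> m' a = m a)"

text \<open>\<open>B\<close> is exactly the range of \<open>ell\<close> hash bits. \<open>K\<close>
  counts one window of coins per hash bit and repetition. \<open>N_bits\<close> says that
  \<open>bits\<close> binary digits suffice for every identifier.\<close>

locale hash_layout = layout +
  assumes B_eq: "B = 2 ^ ell" and R_eq: "R = L * B" and K_eq: "K = L * (ell * bits)"
    and L_pos: "0 < L" and ell_pos: "0 < ell" and N_bits: "N * N \<le> 2 ^ bits"
begin

definition has_coins :: "(nat \<Rightarrow> nat) \<Rightarrow> (nat \<Rightarrow> nat) \<Rightarrow> bool" where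
  "has_coins cs m \<longleftrightarrow> (\<forall>i<K. m (64 + i) = cs i \<and> cs i \<le> 1)"

lemma same_except_regs: "same_except X m m' \<Longrightarrow> X \<subseteq> {21..<64} \<Longrightarrow> regs m \<Longrightarrow> regs m'"
  by (rule agree_except_regs[of X m m']) (auto simp: same_except_def agree_except_def)

lemma same_except_coins: "same_except X m m' \<Longrightarrow> X \<subseteq> {21..<64} \<Longrightarrow> has_coins cs m \<Longrightarrow> has_coins cs m'"
  unfolding same_except_def has_coins_def by (metis add_leD1 atLeastLessThan_iff not_add_less1 subsetD)

lemma bits_le_K: "bits \<le> K"
  using L_pos ell_pos by (simp add: K_eq)

lemma B_le_R: "B \<le> R"
  using L_pos by (simp add: R_eq)

lemma R_pos: "0 < R"
  using L_pos by (simp add: R_eq B_eq)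

lemma L_less_w: "L < 2 ^ w"
proof -
  have "L \<le> R" by (simp add: R_eq B_eq)
  then show ?thesis by (intro lt_S_w) simp
qed

lemma ell_less_B: "ell < B"
  by (simp add: B_eq)

lemma wp_parity:
  assumes m: "regs m" "has_coins cs m" and p: "m 23 = 64 + p" "p + bits \<le> K"
    and x: "m 21 = x" "x < 2 ^ w"
  shows "wp w S parity_prog (\<lambda>k m' \<omega>'. k \<le> 9 * bits + 6 \<and> same_except {23, 27, 28, 29, 30, 35} m m' \<and>
    m' 23 = 64 + p + bits \<and> m' 27 = parity bits cs p x) m \<omega>"
proof -
  define s where "s i = (\<Sum>i<i. (x div 2 ^ i mod 2) * cs (p + i))" for i
  \<comment> \<open>The inner product is reduced modulo 2 only at the end; until then it is at most
    \<open>bits \<le> K\<close> and fits into a word.\<close>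
  have s_le: "s i \<le> i" if "i \<le> bits" for i
  proof -
    have "s i \<le> (\<Sum>j<i. 1)" unfolding s_def
    proof (rule sum_mono)
      fix j assume "j \<in> {..<i}"
      then have "cs (p + j) \<le> 1" "x div 2 ^ j mod 2 \<le> 1"
        using m(2) p(2) that unfolding has_coins_def by auto
      then show "x div 2 ^ j mod 2 * cs (p + j) \<le> 1" using mult_le_mono[of _ 1 _ 1] by simp
    qed
    then show ?thesis by simp
  qed
  let ?X = "{23, 27, 28, 29, 30, 35} :: nat set"
  define I where "I i = (\<lambda>m' (\<omega>'::bool stream). same_except ?X m m' \<and> m' 27 = s i \<and> m' 28 = x div 2 ^ i \<and>
    m' 29 = bits - i \<and> m' 23 = 64 + p + i)" for i
  have loop: "wp w S (WhileNZ 29 (block [Op Mod 35 28 8, Load 30 23, Op Mul 35 35 30, Op Add 27 27 35,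
       Op Div 28 28 8, Op Add 23 23 7, Op Sub 29 29 7]))
     (\<lambda>k m' \<omega>'. k \<le> bits * (8 + 1) + 1 \<and> I bits m' \<omega>') m' \<omega>'" if "I 0 m' \<omega>'" for m' \<omega>'
  proof (rule wp_WhileNZ[where I = I])
    show "I 0 m' \<omega>'" by (rule that)
    show "29 < S" by simp
    show "m' 29 = 0" if "I bits m' \<omega>'" for m' \<omega>' using that by (simp add: I_def)
    fix i m' \<omega>' assume i: "i < bits" and I: "I i m' \<omega>'"
    from I have sm: "same_except ?X m m'" and v: "m' 27 = s i" "m' 28 = x div 2 ^ i"
      "m' 29 = bits - i" "m' 23 = 64 + p + i" unfolding I_def by blast+
    have c: "m' 7 = 1" "m' 8 = 2" using same_except_regs[OF sm _ m(1)] by (auto simp: regs_def)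
    have "has_coins cs m'" by (rule same_except_coins[OF sm _ m(2)]) auto
    then have cs: "m' (64 + p + i) = cs (p + i)" "cs (p + i) \<le> 1"
      using i p(2) by (auto simp: has_coins_def add.assoc)
    have sS: "s (Suc i) = s i + x div 2 ^ i mod 2 * cs (p + i)" by (simp add: s_def)
    have b: "x div 2 ^ i mod 2 * cs (p + i) < 2 ^ w" "x div 2 ^ i mod 2 < 2 ^ w"
       "s i + x div 2 ^ i mod 2 * cs (p + i) < 2 ^ w"
      using s_le[of "Suc i"] i bits_le_K unfolding sS by (auto intro!: lt_S_w)
    have "x div 2 ^ i \<le> x" "x div 2 ^ i div 2 \<le> x" by (auto intro: order_trans[OF div_le_dividend])
    with x(2) have b': "x div 2 ^ i < 2 ^ w" "x div 2 ^ i div 2 < 2 ^ w"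
      by (blast intro: le_less_trans)+
    let ?m = "m'(35 := x div 2 ^ i mod 2, 30 := cs (p + i), 
      35 := x div 2 ^ i mod 2 * cs (p + i), 27 := s (Suc i), 28 := x div 2 ^ Suc i,
       23 := 64 + p + Suc i, 29 := bits - Suc i)"
    have "I (Suc i) ?m \<omega>'"
      using sm unfolding I_def by (auto simp: same_except_def)
    then have "wp w S (block [Op Mod 35 28 8, Load 30 23, Op Mul 35 35 30, Op Add 27 27 35,
       Op Div 28 28 8, Op Add 23 23 7, Op Sub 29 29 7]) (\<lambda>k m' \<omega>'. k \<le> 8 \<and> I (Suc i) m' \<omega>') m' \<omega>'"
      using p(2) i bits_le_K R_pos b b'
      by (simp add: wp_simps wp_block lt_S lt_S_w c v cs sS div_mult2_eq mult.commute[of 2]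
         del: block.simps cong: wp_cong)
    then show "m' 29 \<noteq> 0 \<and> wp w S (block [Op Mod 35 28 8, Load 30 23, Op Mul 35 35 30, Op Add 27 27 35,
       Op Div 28 28 8, Op Add 23 23 7, Op Sub 29 29 7]) (\<lambda>k m' \<omega>'. k \<le> 8 \<and> I (Suc i) m' \<omega>') m' \<omega>'"
      using v i by simp
  qed
  have I0: "I 0 (m(27 := 0, 28 := x, 29 := bits)) \<omega>"
    using p(1) by (simp add: I_def same_except_def s_def)
  show ?thesis
    unfolding parity_prog_def
    using bits_le_K R_pos p x m(1)[unfolded regs_def]
    apply (simp add: wp_simps wp_block lt_S lt_S_w del: block.simps cong: wp_cong)
  proof (rule wp_mono[OF loop[OF I0]], goal_cases)
    case (1 k m' \<omega>')
    then have "m' 8 = 2" "m' 27 = s bits" using m(1) by (simp_all add: I_def same_except_def regs_def)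
    moreover have "s bits mod 2 < 2 ^ w" by (rule lt_S_w) simp
    moreover have "same_except ?X m m'" "m' 23 = 64 + p + bits" "k \<le> 9 * bits + 1"
      using 1 by (auto simp: I_def)
    moreover have "same_except ?X m (m'(27 := v))" if "same_except ?X m m'" for v
      using that by (auto simp: same_except_def)
    ultimately show ?case
      by (simp add: wp_simps wp_block parity_def s_def)
  qed
qed

lemma same_except_trans: "same_except X m m' \<Longrightarrow> same_except Y m' m'' \<Longrightarrow> X \<union> Y \<subseteq> Z \<Longrightarrow> same_except Z m m''"
  unfolding same_except_def by (metis Un_iff subsetD)

lemma wp_hash:
  assumes m: "regs m" "has_coins cs m" and p: "m 23 = 64 + p" "p + ell * bits \<le> K"
    and x: "m 21 = x" "x < 2 ^ w"
  shows "wp w S hash_prog (\<lambda>k m' \<omega>'. k \<le> ell * (9 * bits + 11) + 4 \<and>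
    same_except {23, 25, 26, 27, 28, 29, 30, 35} m m' \<and>
    m' 23 = 64 + p + ell * bits \<and> m' 25 = hash_value bits cs p x ell) m \<omega>"
proof -
  let ?X = "{23, 25, 26, 27, 28, 29, 30, 35} :: nat set"
  let ?b = "[parity_prog, Op Mul 25 25 8, Op Add 25 25 27, Op Sub 26 26 7]"
  define I where "I i = (\<lambda>m' (\<omega>'::bool stream). same_except ?X m m' \<and> m' 25 = hash_value bits cs p x i \<and>
    m' 26 = ell - i \<and> m' 23 = 64 + p + i * bits)" for i
  have loop: "wp w S (WhileNZ 26 (block ?b))
     (\<lambda>k m' \<omega>'. k \<le> ell * (9 * bits + 10 + 1) + 1 \<and> I ell m' \<omega>') m' \<omega>'" if "I 0 m' \<omega>'" for m' \<omega>'
  proof (rule wp_WhileNZ[where I = I])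
    show "I 0 m' \<omega>'" by (rule that)
    show "26 < S" by simp
    show "m' 26 = 0" if "I ell m' \<omega>'" for m' \<omega>' using that by (simp add: I_def)
    fix i m' \<omega>' assume i: "i < ell" and I: "I i m' \<omega>'"
    from I have sm: "same_except ?X m m'" and v: "m' 25 = hash_value bits cs p x i"
      "m' 26 = ell - i" "m' 23 = 64 + (p + i * bits)" unfolding I_def by auto
    have r: "regs m'" by (rule same_except_regs[OF sm _ m(1)]) auto
    have c: "has_coins cs m'" by (rule same_except_coins[OF sm _ m(2)]) auto
    have "Suc i * bits \<le> ell * bits" using i by (intro mult_le_mono1) simp
    then have p': "p + i * bits + bits \<le> K" using p(2) by simp
    have x': "m' 21 = x" using sm x by (simp add: same_except_def)
    have "wp w S (block ?b) (\<lambda>k m' \<omega>'. k \<le> 9 * bits + 10 \<and> I (Suc i) m' \<omega>') m' \<omega>'"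
      unfolding wp_block
    proof (rule wp_mono[OF wp_parity[OF r c v(3) p' x' x(2)]], goal_cases)
      case (1 k m'' \<omega>'')
      then have sm': "same_except {23, 27, 28, 29, 30, 35} m' m''" and v': "m'' 27 = parity bits cs (p + i * bits) x"
         "m'' 23 = 64 + (p + i * bits) + bits" "k \<le> 9 * bits + 6" by auto
      have c': "m'' 7 = 1" "m'' 8 = 2" "m'' 25 = hash_value bits cs p x i" "m'' 26 = ell - i"
        using sm' r v by (auto simp: same_except_def regs_def)
      have sm'': "same_except ?X m m''" by (rule same_except_trans[OF sm sm']) auto
      have "hash_value bits cs p x (Suc i) < B"
        using hash_value_less[of bits cs p x "Suc i"] i power_increasing[of "Suc i" ell "2::nat"]
        unfolding B_eq by simp
      then have "2 * hash_value bits cs p x i + parity bits cs (p + i * bits) x < 2 ^ w"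
        using B_le_R by (auto intro!: lt_S_w)
      moreover have "I (Suc i) (m''(25 := hash_value bits cs p x (Suc i), 26 := ell - Suc i)) \<omega>''"
        using sm'' v' unfolding I_def by (auto simp: same_except_def)
      ultimately show ?case
        using i ell_less_B B_le_R v'(3)
        by (simp add: wp_simps lt_S_w c' v'(1,2) mult.commute[of _ 2])
    qed
    then show "m' 26 \<noteq> 0 \<and> wp w S (block ?b) (\<lambda>k m' \<omega>'. k \<le> 9 * bits + 10 \<and> I (Suc i) m' \<omega>') m' \<omega>'"
      using v i by simp
  qed
  have I0: "I 0 (m(25 := 0, 26 := ell)) \<omega>"
    using p(1) by (simp add: I_def same_except_def)
  show ?thesis
    unfolding hash_prog_def
    using ell_less_B B_le_R p x m(1)[unfolded regs_def]
    apply (simp add: wp_simps wp_block lt_S lt_S_w del: block.simps cong: wp_cong)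
  proof (rule wp_mono[OF loop[OF I0]], goal_cases)
    case (1 k m' \<omega>')
    then show ?case by (simp add: wp_simps wp_block I_def algebra_simps)
  qed
qed

text \<open>One index addresses all buckets: \<open>q div B\<close> is the repetition and
  \<open>q mod B\<close> the hash value.\<close>

definition bucket :: "(nat \<Rightarrow> nat) \<Rightarrow> nat set \<Rightarrow> nat \<Rightarrow> nat set" where
  "bucket cs V q = {y \<in> V. hash_value bits cs (q div B * (ell * bits)) y ell = q mod B}"

definition sketch :: "(nat \<Rightarrow> nat) \<Rightarrow> nat set \<Rightarrow> (nat \<Rightarrow> nat) \<Rightarrow> bool" where
  "sketch cs V m \<longleftrightarrow> regs m \<and> has_coins cs m \<and> V \<subseteq> {..<N * N} \<and>
     (\<exists>os. table (bucket cs V) os m \<and> set os = {q. q < R \<and> card (bucket cs V q) = 1})"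

text \<open>Each repetition changes exactly one bucket, so the time is \<open>L\<close> times the
  cost of one hash evaluation and one bucket update. The buckets of different repetitions, and their
  windows of coins, are reached by adding fixed offsets.\<close>

lemma wp_update:
  assumes m: "sketch cs V m"
    and e: "m 2 < N" "m 3 < N" "x = min (m 2) (m 3) * N + max (m 2) (m 3)"
    and V': "if m 1 = 0 then x \<in> V \<and> V' = V - {x} else x \<notin> V \<and> V' = insert x V"
  shows "wp w S update_prog (\<lambda>k m' \<omega>'. k \<le> L * (ell * (9 * bits + 11) + 78) + 11 \<and>
    m' 6 = m 6 \<and> sketch cs V' m') m \<omega>"
proof -
  let ?X = "{4} \<union> {22..<38} :: nat set"
  let ?b = "[hash_prog, bucket_prog, Op Add 22 22 11, Op Sub 24 24 7]"
  let ?D = "bucket cs V" and ?D' = "bucket cs V'"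
  \<comment> \<open>the buckets after the first \<open>j\<close> repetitions have been updated\<close>
  define E where "E j q = (if q div B < j then ?D' q else ?D q)" for j q
  from m obtain os0 where i: "regs m" "has_coins cs m" "V \<subseteq> {..<N * N}"
    "table ?D os0 m" "set os0 = {q. q < R \<and> card (?D q) = 1}" unfolding sketch_def by blast
  have x: "x < N * N"
  proof -
    have "x < min (m 2) (m 3) * N + N" using e by simp
    also have "\<dots> = Suc (min (m 2) (m 3)) * N" by simp
    also have "\<dots> \<le> N * N" using e by (intro mult_le_mono1) simp
    finally show ?thesis .
  qed
  define I where "I j = (\<lambda>m' (\<omega>'::bool stream). agree_except ({21} \<union> ?X) m m' \<and> m' 21 = x \<and>
    m' 22 = j * B \<and> m' 23 = 64 + j * (ell * bits) \<and> m' 24 = L - j \<and>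
    (\<exists>os. table (E j) os m' \<and> set os = {q. q < R \<and> card (E j q) = 1}))" for j
  have loop: "wp w S (WhileNZ 24 (block ?b))
     (\<lambda>k m' \<omega>'. k \<le> L * (ell * (9 * bits + 11) + 77 + 1) + 1 \<and> I L m' \<omega>') m' \<omega>'" if "I 0 m' \<omega>'" for m' \<omega>'
  proof (rule wp_WhileNZ[where I = I])
    show "I 0 m' \<omega>'" by (rule that)
    show "24 < S" by simp
    show "m' 24 = 0" if "I L m' \<omega>'" for m' \<omega>' using that by (simp add: I_def)
    fix j m' \<omega>' assume j: "j < L" and I: "I j m' \<omega>'"
    from I obtain os where a: "agree_except ({21} \<union> ?X) m m'" and v: "m' 21 = x" "m' 22 = j * B"
      "m' 23 = 64 + j * (ell * bits)" "m' 24 = L - j"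
      and os: "table (E j) os m'" "set os = {q. q < R \<and> card (E j q) = 1}" unfolding I_def by blast
    have r: "regs m'" by (rule agree_except_regs[OF a _ i(1)]) auto
    have c: "has_coins cs m'" using i(2) a by (auto simp: has_coins_def agree_except_def)
    have "Suc j * (ell * bits) \<le> L * (ell * bits)" using j by (intro mult_le_mono1) simp
    then have p: "j * (ell * bits) + ell * bits \<le> K" by (simp add: K_eq)
    have "Suc j * B \<le> L * B" using j by (intro mult_le_mono1) simp
    then have jB: "j * B + B \<le> R" by (simp add: R_eq)
    define h where "h = hash_value bits cs (j * (ell * bits)) x ell"
    have h: "h < B" unfolding h_def B_eq by (rule hash_value_less)
    define q where "q = j * B + h"
    have q: "q < R" "q div B = j" "q mod B = h" using jB h by (auto simp: q_def)
    have D: "if m 1 = 0 then x \<in> E j q \<and> ?D' q = E j q - {x} else x \<notin> E j q \<and> ?D' q = insert x (E j q)"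
      using V' q by (auto simp: E_def bucket_def h_def split: if_splits)
    \<comment> \<open>Within repetition \<open>j\<close>, \<open>x\<close> belongs to bucket
      \<open>q\<close> only; the other buckets do not see the difference between \<open>V\<close>
      and \<open>V'\<close>.\<close>
    have E_Suc: "(E j)(q := ?D' q) = E (Suc j)"
    proof
      fix r
      show "((E j)(q := ?D' q)) r = E (Suc j) r"
      proof (cases "r \<noteq> q \<and> r div B = j")
        case True
        then have "r mod B \<noteq> h" using q by (metis div_mod_decomp)
        then have "?D r = ?D' r" using V' True by (auto simp: bucket_def h_def split: if_splits)
        then show ?thesis using True by (simp add: E_def)
      next
        case False
        then show ?thesis using q by (auto simp: E_def)
      qed
    qed
    have xw: "x < 2 ^ w" using x N_w by (metis le_square less_imp_le_nat order_le_less_trans order_less_le_trans)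
    have "wp w S (block ?b) (\<lambda>k m' \<omega>'. k \<le> ell * (9 * bits + 11) + 77 \<and> I (Suc j) m' \<omega>') m' \<omega>'"
      unfolding wp_block
    proof (rule wp_mono[OF wp_hash[OF r c v(3) p v(1) xw]], goal_cases)
      case (1 k m1 \<omega>1)
      then have sm: "same_except {23, 25, 26, 27, 28, 29, 30, 35} m' m1" and v1: "m1 25 = h"
        "m1 23 = 64 + j * (ell * bits) + ell * bits" "k \<le> ell * (9 * bits + 11) + 4"
        by (auto simp: h_def)
      have r1: "regs m1" by (rule same_except_regs[OF sm _ r]) auto
      have "agree_except {23, 25, 26, 27, 28, 29, 30, 35} m' m1"
        using sm by (simp add: same_except_def agree_except_def)
      then have a1: "agree_except ({21} \<union> ?X) m m1" by (rule agree_except_trans[OF a]) auto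
      have v1': "m1 21 = x" "m1 22 = j * B" "m1 24 = L - j" "m1 1 = m 1"
        using sm v a by (auto simp: same_except_def agree_except_def)
      have os1: "table (E j) os m1" using os(1) sm by (simp add: table_def same_except_def)
      have q1: "m1 22 + m1 25 = q" using v1 v1' by (simp add: q_def)
      have D1: "if m1 1 = 0 then x \<in> E j q \<and> ?D' q = E j q - {x} else x \<notin> E j q \<and> ?D' q = insert x (E j q)"
        unfolding v1' by (rule D)
      show ?case
      proof (rule wp_mono[OF wp_bucket[OF r1 os1 os(2) q1 q(1) v1'(1) x D1]], unfold E_Suc, goal_cases)
        case (1 k2 m2 \<omega>2)
        then obtain os2 where a2: "agree_except ({4} \<union> {28..<38}) m1 m2" and
          os2: "table (E (Suc j)) os2 m2" "set os2 = {q. q < R \<and> card (E (Suc j) q) = 1}" and k2: "k2 \<le> 70"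
          by blast
        have v2: "m2 21 = x" "m2 22 = j * B" "m2 24 = L - j" "m2 23 = 64 + Suc j * (ell * bits)"
           using a2 v1 v1' by (simp_all add: agree_except_def)
        have r2: "m2 7 = 1" "m2 11 = B" using a2 r1 by (simp_all add: agree_except_def regs_def)
        have a2': "agree_except ({21} \<union> ?X) m m2" by (rule agree_except_trans[OF a1 a2]) auto
        let ?m = "m2(22 := j * B + B, 24 := L - Suc j)"
        have "agree_except ({21} \<union> ?X) m ?m" using a2' by (simp add: agree_except_def)
        moreover have "table (E (Suc j)) os2 ?m" using os2(1) by (simp add: table_def)
        ultimately have "I (Suc j) ?m \<omega>2"
          using os2(2) v2 unfolding I_def by auto
        then show ?case using k2 v1(3) j jB B_eq v2 L_less_w
          by (simp add: wp_simps lt_S_w r2 R_eq)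
      qed
    qed
    then show "m' 24 \<noteq> 0 \<and> wp w S (block ?b) (\<lambda>k m' \<omega>'. k \<le> ell * (9 * bits + 11) + 77 \<and> I (Suc j) m' \<omega>') m' \<omega>'"
      using v j by simp
  qed
  let ?a = "min (m 2) (m 3)" and ?b = "max (m 2) (m 3)"
  have ab: "m 2 - (m 2 - m 3) = ?a" "m 3 + (m 2 - m 3) = ?b" by auto
  have NN: "N \<le> N * N" "N * N \<le> N * N * (N * N)" using N_pos by simp_all
  have w: "m 2 - m 3 < 2 ^ w" "?a < 2 ^ w" "?b < 2 ^ w" "?a * N < 2 ^ w" "x < 2 ^ w" "L < 2 ^ w"
  proof -
    have "N < 2 ^ w" "x < 2 ^ w" "?a < N" "?b < N" "m 2 - m 3 < N" "?a * N \<le> x"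
      using NN x N_w e by linarith+
    with L_less_w show "m 2 - m 3 < 2 ^ w" "?a < 2 ^ w" "?b < 2 ^ w" "?a * N < 2 ^ w" "x < 2 ^ w"
      "L < 2 ^ w" by linarith+
  qed
  let ?m = "m(35 := m 2 - m 3, 30 := ?b, 21 := x, 22 := 0, 23 := 64, 24 := L)"
  have "table (E 0) os0 ?m" "set os0 = {q. q < R \<and> card (E 0 q) = 1}"
    using i(4,5) by (simp_all add: table_def E_def)
  moreover have "agree_except ({21} \<union> ?X) m ?m" by (simp add: agree_except_def)
  ultimately have I0: "I 0 ?m \<omega>" unfolding I_def by auto
  show ?thesis
    unfolding update_prog_def
    using w R_pos
    apply (simp add: wp_simps wp_block lt_S lt_S_w i(1)[unfolded regs_def] ab e(3)[symmetric]
        del: block.simps cong: wp_cong)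
  proof (rule wp_mono[OF loop], goal_cases)
    case 1
    show ?case using I0 by simp
  next
    case (2 k m' \<omega>')
    from 2 have "I L m' \<omega>'" by blast
    then obtain os where a: "agree_except ({21} \<union> ?X) m m'"
      and os: "table (E L) os m'" "set os = {q. q < R \<and> card (E L q) = 1}"
      unfolding I_def by blast
    from 2 have k: "k \<le> L * (ell * (9 * bits + 11) + 78) + 1" by (simp add: add.commute)
    have r: "regs m'" by (rule agree_except_regs[OF a _ i(1)]) auto
    have c: "has_coins cs m'" using i(2) a by (auto simp: has_coins_def agree_except_def)
    have EL: "E L q = ?D' q" if "q < R" for q
      using that by (simp add: E_def R_eq less_mult_imp_div_less)
    have "table ?D' os m'"
      using os(1) EL unfolding table_def by (auto simp: subset_iff)
    moreover have "set os = {q. q < R \<and> card (?D' q) = 1}" using os(2) EL by auto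
    moreover have "V' \<subseteq> {..<N * N}" using V' i(3) x by (auto split: if_splits)
    moreover have "m' 6 = m 6" using a by (simp add: agree_except_def)
    ultimately show ?case using r c k by (auto simp: add.commute wp_simps wp_block sketch_def)
  qed
qed

end

subsection \<open>Initialization\<close>

text \<open>The logarithm is obtained by counting doublings; the truncated difference of cells
  \<open>x\<close> and \<open>p\<close> becomes zero as soon as the power of two in \<open>p\<close>
  has reached the number in \<open>x\<close>.\<close>

definition doubling_prog :: "nat \<Rightarrow> nat \<Rightarrow> nat \<Rightarrow> nat \<Rightarrow> prog" where
  "doubling_prog x t p e = block [SetConst p 1, SetConst e 0, Op Sub t x p,
     WhileNZ t (block [Op Mul p p 8, Op Add e e 7, Op Sub t x p])]"

text \<open>Only the constants \<open>A\<close> and \<open>A'\<close> are built in; all other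
  parameters are computed from \<open>n\<close>, so that one program serves every \<open>n\<close>.
  Multiplication by the 1 in cell 7 copies a cell.\<close>

definition init_prog :: "nat \<Rightarrow> nat \<Rightarrow> prog" where
  "init_prog A A' = block [SetConst 7 1, SetConst 8 2,
     doubling_prog 0 21 9 10,
     SetConst 22 A, Op Mul 22 22 9, Op Mul 22 22 10, Op Mul 22 22 10,
     doubling_prog 22 21 11 12,
     SetConst 13 A', Op Mul 13 13 10, Op Add 14 10 10, Op Mul 15 12 14, Op Mul 15 13 15,
     Op Mul 16 13 11, SetConst 23 64, Op Add 17 23 15, Op Add 18 17 16, Op Add 19 18 16,
     Op Add 20 19 16, Op Add 5 20 16, Op Mul 24 15 7,
     WhileNZ 24 (block [Flip 30, Store 23 30, Op Add 23 23 7, Op Sub 24 24 7]),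
     SetConst 6 1]"

text \<open>Cell 6 is zero until the initialization, which is part of the first update, has been done.\<close>

definition main_prog :: "nat \<Rightarrow> nat \<Rightarrow> prog" where
  "main_prog A A' = Seq (IfNZ 6 Skip (init_prog A A')) update_prog"

text \<open>The last doubling starts below \<open>X\<close>, so \<open>2 * X < 2 ^ w\<close>
  prevents an overflow.\<close>

lemma wp_doubling:
  assumes m: "m 7 = 1" "m 8 = 2" "m x = X" and X: "0 < X" "2 * X < 2 ^ w"
    and d: "distinct [x, t, p, e, 7, 8]" and S: "x < S" "t < S" "p < S" "e < S" "7 < S" "8 < S"
  shows "wp w S (doubling_prog x t p e) (\<lambda>k m' \<omega>'. k \<le> 5 * ceillog2 X + 5 \<and> \<omega>' = \<omega> \<and>
    same_except {t, p, e} m m' \<and> m' p = 2 ^ ceillog2 X \<and> m' e = ceillog2 X) m \<omega>"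
proof -
  have d': "t \<noteq> x" "p \<noteq> x" "e \<noteq> x" "p \<noteq> t" "e \<noteq> t" "e \<noteq> p" "7 \<noteq> x" "7 \<noteq> t" "7 \<noteq> p" "7 \<noteq> e"
    "8 \<noteq> x" "8 \<noteq> t" "8 \<noteq> p" "8 \<noteq> e" using d by auto
  let ?b = "[Op Mul p p 8, Op Add e e 7, Op Sub t x p]" and ?c = "ceillog2 X"
  define I where "I i = (\<lambda>m' \<omega>'. \<omega>' = \<omega> \<and> same_except {t, p, e} m m' \<and> m' p = 2 ^ i \<and> m' e = i \<and>
    m' t = X - 2 ^ i)" for i
  have loop: "wp w S (WhileNZ t (block ?b)) (\<lambda>k m' \<omega>'. k \<le> ?c * (4 + 1) + 1 \<and> I ?c m' \<omega>') m' \<omega>'"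
    if "I 0 m' \<omega>'" for m' \<omega>'
  proof (rule wp_WhileNZ[where I = I])
    show "I 0 m' \<omega>'" by (rule that)
    show "t < S" by (rule S)
    show "m' t = 0" if "I ?c m' \<omega>'" for m' \<omega>'
      using that ceillog2_le_iff[OF X(1), of ?c] by (simp add: I_def)
    fix i m' \<omega>' assume i: "i < ?c" and I: "I i m' \<omega>'"
    have lt: "2 ^ i < X" using i ceillog2_le_iff[OF X(1), of i] by simp
    from I have v: "\<omega>' = \<omega>" "same_except {t, p, e} m m'" "m' p = 2 ^ i" "m' e = i" "m' t = X - 2 ^ i"
      unfolding I_def by blast+
    have v': "m' 7 = 1" "m' 8 = 2" "m' x = X" using v(2) d m by (auto simp: same_except_def)
    have "i < 2 ^ i" by simp
    with lt X have b: "2 ^ i * 2 < (2::nat) ^ w" "Suc i < 2 ^ w" "X - 2 * 2 ^ i < 2 ^ w" by linarith+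
    have "same_except {t, p, e} m (m'(p := u, e := v, t := z))" for u v z
      using v(2) by (auto simp: same_except_def)
    then have "I (Suc i) (m'(p := 2 * 2 ^ i, e := Suc i, t := X - 2 * 2 ^ i)) \<omega>'"
      using v d unfolding I_def by auto
    then show "m' t \<noteq> 0 \<and> wp w S (block ?b) (\<lambda>k m' \<omega>'. k \<le> 4 \<and> I (Suc i) m' \<omega>') m' \<omega>'"
      using v lt b d d' S by (simp add: wp_simps wp_block v' mult.commute del: block.simps cong: wp_cong)
  qed
  have I0: "I 0 (m(p := 1, e := 0, t := X - 1)) \<omega>"
    using d d' by (simp add: I_def same_except_def)
  have "1 < (2::nat) ^ w" "X - 1 < 2 ^ w" "X - Suc 0 < 2 ^ w" using X by linarith+
  then show ?thesis
    unfolding doubling_prog_def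
    using d d' S m
    apply (simp add: wp_simps wp_block del: block.simps cong: wp_cong)
  proof (rule wp_mono[OF loop], goal_cases)
    case 1
    show ?case using I0 by simp
  next
    case (2 k m' \<omega>')
    then show ?case by (simp add: wp_Skip I_def)
  qed
qed

context hash_layout begin

text \<open>The time bound contains the number \<open>K\<close> of coins but not the number
  \<open>R\<close> of buckets: the table of the empty set is already present.\<close>

lemma wp_init:
  assumes n: "2 \<le> n" and A: "2 \<le> A" "0 < A'"
    and p: "lg = ceillog2 n" "N = 2 ^ lg" "ell = ceillog2 (A * N * lg * lg)" "L = A' * lg"
      "bits = lg + lg"
    and m: "m 0 = n" "\<And>a. 4 \<le> a \<Longrightarrow> m a = 0"
  shows "wp w S (init_prog A A') (\<lambda>k m' \<omega>'. k \<le> 5 * lg + 5 * ell + 6 * K + 50 \<and>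
    same_except (- {0, 1, 2, 3}) m m' \<and> m' 6 = 1 \<and> sketch (\<lambda>i. of_bool (\<omega> !! i)) {} m') m \<omega>"
proof -
  let ?T = "A * N * lg * lg"
  have lg: "0 < lg" using n ceillog2_le_iff[of n 0] p(1) by (cases "lg = 0") auto
  have nN: "n \<le> N" using ceillog2_le_iff[of n lg] n p(1,2) by simp
  have AN: "A * N \<le> A * N * lg" "A * N * lg \<le> ?T" "A \<le> A * N" "2 * N \<le> A * N"
    using lg A p(2) by simp_all
  have T: "0 < ?T" using lg A p(2) by simp
  have TR: "?T \<le> R" using ceillog2_le_iff[OF T, of ell] p(3) B_eq B_le_R by simp
  have "A' \<le> L" using lg p(4) by simp
  moreover have "L \<le> R" by (simp add: R_eq B_eq)
  moreover have "lg < N" by (simp add: p(2))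
  moreover have "ell < B" by (simp add: B_eq)
  moreover have "ell * bits \<le> K" using L_pos by (simp add: K_eq)
  ultimately have "A < 64 + K + 6 * R" "A * N < 64 + K + 6 * R" "A * N * lg < 64 + K + 6 * R"
    "?T < 64 + K + 6 * R" "A' < 64 + K + 6 * R"
    "L < 64 + K + 6 * R" "lg + lg < 64 + K + 6 * R" "ell * bits < 64 + K + 6 * R"
    "K < 64 + K + 6 * R" "2 * n < 64 + K + 6 * R" "2 * ?T < 64 + K + 6 * R" "2 < 64 + K + 6 * R"
    using AN nN TR by linarith+
  note w = this[THEN lt_S_w]
  have K: "K = L * (ell * bits)" by (rule K_eq)
  let ?Q = "\<lambda>m' (\<omega>'::bool stream). same_except (- {0, 1, 2, 3}) m m' \<and> m' 6 = 1 \<and>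
    sketch (\<lambda>i. of_bool (\<omega> !! i)) {} m'"
  let ?b = "[Flip 30, Store 23 30, Op Add 23 23 7, Op Sub 24 24 7]"
  have flips: "wp w S (WhileNZ 24 (block ?b)) (\<lambda>k m' \<omega>'. k \<le> K * (5 + 1) + 1 \<and>
     (\<forall>a. a \<notin> {23, 24, 30} \<union> {64..<64 + K} \<longrightarrow> m' a = m5 a) \<and>
     (\<forall>j<K. m' (64 + j) = of_bool (\<omega> !! j))) m5 \<omega>"
    if m5: "regs m5" "m5 23 = 64" "m5 24 = K" for m5
  proof -
    define I where "I i = (\<lambda>m' \<omega>'. \<omega>' = sdrop i \<omega> \<and>
      (\<forall>a. a \<notin> {23, 24, 30} \<union> {64..<64 + i} \<longrightarrow> m' a = m5 a) \<and>
      (\<forall>j<i. m' (64 + j) = of_bool (\<omega> !! j)) \<and> m' 23 = 64 + i \<and> m' 24 = K - i)" for i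
    have "wp w S (WhileNZ 24 (block ?b)) (\<lambda>k m' \<omega>'. k \<le> K * (5 + 1) + 1 \<and> I K m' \<omega>') m5 \<omega>"
    proof (rule wp_WhileNZ[where I = I])
      show "I 0 m5 \<omega>" using m5 by (simp add: I_def)
      show "24 < S" by simp
      show "m' 24 = 0" if "I K m' \<omega>'" for m' \<omega>' using that by (simp add: I_def)
      fix i m' \<omega>' assume i: "i < K" and I: "I i m' \<omega>'"
      from I have v: "\<omega>' = sdrop i \<omega>" "m' 23 = 64 + i" "m' 24 = K - i" "m' 7 = 1"
        using m5(1) by (auto simp: I_def regs_def)
      let ?m = "m'(30 := of_bool (\<omega> !! i), 64 + i := of_bool (\<omega> !! i), 23 := 65 + i, 24 := K - Suc i)"
      have A: "?m a = m5 a" if "a \<notin> {23, 24, 30} \<union> {64..<64 + Suc i}" for a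
      proof -
        have "a \<notin> {23, 24, 30} \<union> {64..<64 + i}" "a \<noteq> 64 + i" "a \<notin> {23, 24, 30}" using that by auto
        then show ?thesis using I unfolding I_def by simp
      qed
      have B: "?m (64 + j) = of_bool (\<omega> !! j)" if "j < Suc i" for j
        using I that unfolding I_def by (cases "j = i") simp_all
      have "I (Suc i) ?m (sdrop (Suc i) \<omega>)"
        unfolding I_def by (intro conjI allI impI) (rule refl, erule A, erule B, simp, simp)
      then show "m' 24 \<noteq> 0 \<and> wp w S (block ?b) (\<lambda>k m' \<omega>'. k \<le> 5 \<and> I (Suc i) m' \<omega>') m' \<omega>'"
        using i v R_pos
        by (simp add: wp_simps wp_block lt_S lt_S_w v sdrop_simps del: block.simps sdrop.simps cong: wp_cong)
    qed
    then show ?thesis by (rule wp_mono) (auto simp: I_def)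
  qed
  have fin: "?Q (m6(6 := 1)) \<omega>6" if "same_except {5,7,8,9,10,11,12,13,14,15,16,17,18,19,20,21,22,23,24} m m5"
    "regs m5" "\<forall>a. a \<notin> {23, 24, 30} \<union> {64..<64 + K} \<longrightarrow> m6 a = m5 a"
    "\<forall>j<K. m6 (64 + j) = of_bool (\<omega> !! j)" for m5 m6 \<omega>6
  proof -
    \<comment> \<open>The initialization writes registers and coins only, so the table region and
      the list length keep their initial zeros, and these represent empty buckets and an empty
      list.\<close>
    have z: "m6 (64 + K + q) = 0" "m6 4 = 0" for q using that m(2) by (auto simp: same_except_def)
    have "same_except (- {0, 1, 2, 3}) m (m6(6 := 1))" using that by (auto simp: same_except_def)
    moreover have "regs (m6(6 := 1))" using that by (auto simp: regs_def)
    moreover have "has_coins (\<lambda>i. of_bool (\<omega> !! i)) (m6(6 := 1))"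
      using that by (auto simp: has_coins_def)
    moreover have "table (bucket cs {}) [] (m6(6 := 1))" for cs
      using z z(1)[of "R + q" for q] by (simp add: table_def bucket_def add.assoc)
    ultimately show ?thesis by (auto simp: sketch_def bucket_def)
  qed
  show ?thesis
    unfolding init_prog_def
    using w
    apply (simp add: wp_simps wp_block del: block.simps cong: wp_cong)
  proof (rule wp_mono[OF wp_doubling[where X = n]], goal_cases)
    case (13 k2 m2 \<omega>2)
    then have s2: "same_except {21, 9, 10} (m(7 := 1, 8 := 2)) m2" and v2: "m2 9 = N" "m2 10 = lg"
      "\<omega>2 = \<omega>" "k2 \<le> 5 * lg + 5" using p(1,2) by simp_all
    have c2: "m2 7 = 1" "m2 8 = 2" using s2 by (simp_all add: same_except_def)
    let ?m3 = "m2(22 := ?T)"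
    show ?case
      using w v2(4)
      apply (simp add: wp_simps wp_block c2 v2(1-3) del: block.simps cong: wp_cong)
    proof (rule wp_mono[OF wp_doubling[where X = ?T]], goal_cases)
      case (13 k4 m4 \<omega>4)
      then have s4: "same_except {21, 11, 12} ?m3 m4" and v4: "m4 11 = B" "m4 12 = ell"
        "\<omega>4 = \<omega>" "k4 \<le> 5 * ell + 5" using p(3) B_eq by simp_all
      have c4: "m4 7 = 1" "m4 8 = 2" "m4 9 = N" "m4 10 = lg" using s4 c2 v2 by (simp_all add: same_except_def)
      let ?m5 = "m4(13 := L, 14 := bits, 15 := K, 16 := R, 23 := 64, 17 := 64 + K, 18 := 64 + K + R,
         19 := 2 * R + (64 + K), 20 := 3 * R + (64 + K), 5 := 4 * R + (64 + K), 24 := K)"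
      have r5: "regs ?m5" using c4 v4 by (simp add: regs_def)
      have s5: "same_except {5,7,8,9,10,11,12,13,14,15,16,17,18,19,20,21,22,23,24} m ?m5"
        using s2 s4 by (simp add: same_except_def)
      show ?case
        using w v2(4) v4(4) R_pos
        apply (simp add: wp_simps wp_block c4 v4(1-3) lt_S lt_S_w p(4)[symmetric] p(5)[symmetric]
          K_eq[symmetric] R_eq[symmetric] del: block.simps cong: wp_cong)
      proof (rule wp_mono[OF flips], goal_cases)
        case (4 k6 m6 \<omega>6)
        then have k6: "k6 \<le> 6 * K + 1" and m6:
          "\<forall>a. a \<notin> {23, 24, 30} \<union> {64..<64 + K} \<longrightarrow> m6 a = ?m5 a"
          "\<forall>j<K. m6 (64 + j) = of_bool (\<omega> !! j)"
          by (simp_all add: mult.commute)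
        have "Suc 0 < 2 ^ w" by (rule lt_S_w) simp
        then show ?case using k6 4 fin[OF s5 r5 m6]
          by (simp add: wp_simps wp_block del: block.simps)
      qed (use r5 in simp_all)
    qed (use n w m T c2 v2 in simp_all)
  qed (use n w m in simp_all)
qed

text \<open>The alternative in the assumption separates later updates from the first one, where
  \<open>cs\<close> must be the coins about to be tossed. Initialization leaves cells 0 to 3 alone,
  so the update that was fed in is still there afterwards.\<close>

lemma wp_main:
  assumes n: "2 \<le> n" and A: "2 \<le> A" "0 < A'"
    and p: "lg = ceillog2 n" "N = 2 ^ lg" "ell = ceillog2 (A * N * lg * lg)" "L = A' * lg"
      "bits = lg + lg"
    and m: "m 6 = 1 \<and> sketch cs V m \<or>
      m 0 = n \<and> (\<forall>a\<ge>4. m a = 0) \<and> V = {} \<and> cs = (\<lambda>i. of_bool (\<omega> !! i))"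
    and e: "m 2 < N" "m 3 < N" "x = min (m 2) (m 3) * N + max (m 2) (m 3)"
    and V': "if m 1 = 0 then x \<in> V \<and> V' = V - {x} else x \<notin> V \<and> V' = insert x V"
  shows "wp w S (main_prog A A') (\<lambda>k m' \<omega>'.
    k \<le> 5 * lg + 5 * ell + 6 * K + 62 + L * (ell * (9 * bits + 11) + 78) \<and>
    m' 6 = 1 \<and> sketch cs V' m') m \<omega>"
proof -
  let ?U = "L * (ell * (9 * bits + 11) + 78) + 11"
  have "wp w S (IfNZ 6 Skip (init_prog A A')) (\<lambda>k m' \<omega>'. k \<le> 5 * lg + 5 * ell + 6 * K + 51 \<and>
      same_except (- {0, 1, 2, 3}) m m' \<and> m' 6 = 1 \<and> sketch cs V m') m \<omega>"
  proof (cases "m 6 = 0")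
    case True
    then have z: "m 0 = n" "\<And>a. 4 \<le> a \<Longrightarrow> m a = 0" "V = {}" "cs = (\<lambda>i. of_bool (\<omega> !! i))"
      using m by auto
    have "wp w S (init_prog A A') (\<lambda>k m' \<omega>'. Suc k \<le> 5 * lg + 5 * ell + 6 * K + 51 \<and>
      same_except (- {0, 1, 2, 3}) m m' \<and> m' 6 = 1 \<and> sketch cs V m') m \<omega>"
      using wp_mono[OF wp_init[where m = m and n = n and \<omega> = \<omega>, OF n A p z(1,2)]] unfolding z(3,4) by simp
    then show ?thesis using True by (simp add: wp_IfNZ)
  next
    case False
    then have "m 6 = 1" "sketch cs V m" using m by auto
    then show ?thesis by (simp add: wp_IfNZ wp_Skip same_except_def)
  qed
  then show ?thesis
    unfolding main_prog_def wp_Seq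
  proof (rule wp_mono, goal_cases)
    case (1 k m1 \<omega>1)
    then have m1: "m1 1 = m 1" "m1 2 = m 2" "m1 3 = m 3" "sketch cs V m1" "m1 6 = 1"
      "k \<le> 5 * lg + 5 * ell + 6 * K + 51" by (simp_all add: same_except_def)
    show ?case
      by (rule wp_mono[OF wp_update[where V' = V', OF m1(4), unfolded m1(1-3), OF e V']])
        (use m1(5,6) in auto)
  qed
qed

text \<open>For a bucket with a single element the stored sum is that element, and its quotient and
  remainder by \<open>N\<close> are the end points. The list fits since it has at most
  \<open>R\<close> entries in two blocks of length \<open>R\<close>.\<close>

lemma sketch_stored:
  assumes "sketch cs V m"
  shows "stored_within S (m, \<omega>)"
    and "stored_edges (m, \<omega>) = {{y div N, y mod N} | y. \<exists>q<R. bucket cs V q = {y}}"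
proof -
  from assms obtain os where r: "regs m" and t: "table (bucket cs V) os m"
    and os: "set os = {q. q < R \<and> card (bucket cs V q) = 1}" unfolding sketch_def by blast
  from r t have m: "m 5 = 64 + K + 4 * R" "m 4 = length os" by (auto simp: regs_def table_def)
  show "stored_within S (m, \<omega>)"
    using table_length[OF t] m by (simp add: stored_within_def S_eq)
  have l: "m (64 + K + 4 * R + 2 * i) = \<Sum>(bucket cs V (os ! i)) div N"
    "m (64 + K + 4 * R + 2 * i + 1) = \<Sum>(bucket cs V (os ! i)) mod N" if "i < length os" for i
    using t that unfolding table_def by auto
  have "stored_edges (m, \<omega>) =
      (\<lambda>q. {\<Sum>(bucket cs V q) div N, \<Sum>(bucket cs V q) mod N}) ` set os"
    unfolding stored_edges_def Let_def fst_conv m set_conv_nth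
    using l by (auto simp: image_iff) (metis (no_types))+
  also have "\<dots> = {{y div N, y mod N} | y. \<exists>q<R. bucket cs V q = {y}}"
  proof -
    have "set os = {q. q < R \<and> (\<exists>y. bucket cs V q = {y})}"
      unfolding os by (simp add: card_1_singleton_iff)
    moreover have "F ` {q. q < R \<and> (\<exists>y. b q = {y})} = {G y | y. \<exists>q<R. b q = {y}}"
      if "\<And>q y. b q = {y} \<Longrightarrow> F q = G y" for F G :: "nat \<Rightarrow> nat set" and b :: "nat \<Rightarrow> nat set"
    proof (intro set_eqI iffI)
      fix z assume "z \<in> F ` {q. q < R \<and> (\<exists>y. b q = {y})}"
      then obtain q y where "q < R" "b q = {y}" "z = F q" by blast
      then show "z \<in> {G y | y. \<exists>q<R. b q = {y}}" using that by blast
    next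
      fix z assume "z \<in> {G y | y. \<exists>q<R. b q = {y}}"
      then obtain q y where "q < R" "b q = {y}" "z = G y" by blast
      then show "z \<in> F ` {q. q < R \<and> (\<exists>y. b q = {y})}" using that by blast
    qed
    ultimately show ?thesis by simp
  qed
  finally show "stored_edges (m, \<omega>) = {{y div N, y mod N} | y. \<exists>q<R. bucket cs V q = {y}}" .
qed

end

subsection \<open>Collision probability\<close>

definition coin :: "bool list \<Rightarrow> nat \<Rightarrow> nat" where
  "coin xs i = of_bool (xs ! i)"

definition flip :: "nat \<Rightarrow> bool list \<Rightarrow> bool list" where
  "flip i xs = xs[i := \<not> xs ! i]"

text \<open>A combinatorial form of the statement that membership in \<open>C\<close> does not
  depend on the coins from position \<open>p\<close> on. It replaces conditional
  independence.\<close>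

definition flip_closed :: "nat \<Rightarrow> bool list set \<Rightarrow> bool" where
  "flip_closed p C \<longleftrightarrow> (\<forall>xs\<in>C. \<forall>i\<ge>p. i < length xs \<longrightarrow> flip i xs \<in> C)"

lemma length_flip [simp]: "length (flip i xs) = length xs"
  by (simp add: flip_def)

lemma flip_flip: "i < length xs \<Longrightarrow> flip i (flip i xs) = xs"
  by (simp add: flip_def)

lemma coin_flip: "i < length xs \<Longrightarrow> coin (flip i xs) j = (if j = i then 1 - coin xs j else coin xs j)"
  by (auto simp: coin_def flip_def nth_list_update)

text \<open>Flipping position \<open>i\<close> is an involution of \<open>C\<close> that exchanges
  the outcomes with and without \<open>P\<close>.\<close>

lemma card_flip_half:
  assumes C: "finite C" "\<And>xs. xs \<in> C \<Longrightarrow> i < length xs \<and> flip i xs \<in> C"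
    and P: "\<And>xs. xs \<in> C \<Longrightarrow> P (flip i xs) \<longleftrightarrow> \<not> P xs"
  shows "2 * card {xs \<in> C. P xs} = card C"
proof -
  have "bij_betw (flip i) {xs \<in> C. P xs} {xs \<in> C. \<not> P xs}"
    by (rule bij_betw_byWitness[where f' = "flip i"]) (use C P in \<open>auto simp: flip_flip\<close>)
  then have "card {xs \<in> C. P xs} = card {xs \<in> C. \<not> P xs}" by (rule bij_betw_same_card)
  moreover have "card C = card {xs \<in> C. P xs} + card {xs \<in> C. \<not> P xs}"
    using C(1) by (subst card_Un_disjoint[symmetric]) (auto intro: arg_cong[where f = card])
  ultimately show ?thesis by simp
qed

text \<open>Only summand \<open>i\<close> changes, namely by the \<open>i\<close>-th binary digit of
  \<open>x\<close>, so the parity is preserved precisely when this digit is 0.\<close>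

lemma parity_flip:
  assumes "i < bits" "p + i < length xs"
  shows "parity bits (coin (flip (p + i) xs)) p x = parity bits (coin xs) p x \<longleftrightarrow>
    x div 2 ^ i mod 2 = 0"
proof -
  let ?g = "\<lambda>c j. (x div 2 ^ j mod 2) * c (p + j)"
  define r where "r = (\<Sum>j\<in>{..<bits} - {i}. ?g (coin xs) j)"
  have 1: "(\<Sum>j<bits. ?g (coin xs) j) = ?g (coin xs) i + r"
    unfolding r_def using assms by (subst sum.remove[of _ i]) auto
  have 2: "(\<Sum>j<bits. ?g (coin (flip (p + i) xs)) j) = ?g (coin (flip (p + i) xs)) i + r"
    unfolding r_def using assms
    by (subst sum.remove[of _ i]) (auto simp: coin_flip intro!: sum.cong)
  have "coin xs (p + i) = 0 \<or> coin xs (p + i) = 1" by (auto simp: coin_def)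
  moreover have "x div 2 ^ i mod 2 = 0 \<or> x div 2 ^ i mod 2 = 1" by auto
  moreover have "Suc r mod 2 \<noteq> r mod 2" by presburger
  ultimately show ?thesis
    unfolding parity_def 1 2 using assms by (auto simp: coin_flip)
qed

lemma parity_cong: "(\<And>i. i < bits \<Longrightarrow> cs (p + i) = cs' (p + i)) \<Longrightarrow> parity bits cs p x = parity bits cs' p x"
  unfolding parity_def by simp

lemma hash_value_cong:
  "(\<And>i. i < p + k * bits \<Longrightarrow> cs i = cs' i) \<Longrightarrow> hash_value bits cs p x k = hash_value bits cs' p x k"
proof (induction k)
  case (Suc k)
  have "parity bits cs (p + k * bits) x = parity bits cs' (p + k * bits) x"
    by (rule parity_cong) (use Suc.prems in simp)
  with Suc show ?case by simp
qed simp

lemma bits_differ: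
  fixes x y :: nat
  assumes "x < 2 ^ b" "y < 2 ^ b" "x \<noteq> y"
  obtains i where "i < b" "x div 2 ^ i mod 2 \<noteq> y div 2 ^ i mod 2"
proof -
  from assms(3) obtain i where i: "bit x i \<noteq> bit y i" by (auto simp: bit_eq_iff)
  have "i < b"
  proof (rule ccontr)
    assume "\<not> i < b"
    then have "(2::nat) ^ b \<le> 2 ^ i" by simp
    with assms i show False by (simp add: bit_iff_odd)
  qed
  moreover have "x div 2 ^ i mod 2 \<noteq> y div 2 ^ i mod 2"
    using i by (auto simp: bit_iff_odd odd_iff_mod_2_eq_one)
  ultimately show ?thesis using that by blast
qed

text \<open>Every further hash bit halves the set of collisions. The window of bit \<open>k\<close>
  does not influence the earlier bits, so flipping in it a coin where \<open>x\<close> and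
  \<open>y\<close> have different digits stays within the collisions so far, and it alters just one
  of the two parities. The set \<open>C\<close> stands for an event that was decided by earlier
  coins.\<close>

lemma card_collision:
  assumes C: "finite C" "\<And>xs. xs \<in> C \<Longrightarrow> length xs = K" "flip_closed p C"
    and p: "p + k * bits \<le> K" and xy: "x < 2 ^ bits" "y < 2 ^ bits" "x \<noteq> y"
  shows "2 ^ k * card {xs \<in> C. hash_value bits (coin xs) p y k = hash_value bits (coin xs) p x k} = card C"
  using p
proof (induction k)
  case (Suc k)
  let ?C = "{xs \<in> C. hash_value bits (coin xs) p y k = hash_value bits (coin xs) p x k}"
  let ?P = "\<lambda>xs. parity bits (coin xs) (p + k * bits) y = parity bits (coin xs) (p + k * bits) x"
  obtain i where i: "i < bits" "x div 2 ^ i mod 2 \<noteq> y div 2 ^ i mod 2"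
    using bits_differ[OF xy] .
  have par: "parity bits cs q z = 0 \<or> parity bits cs q z = 1" for cs q z
    by (auto simp: parity_def)
  have "2 * card {xs \<in> ?C. ?P xs} = card ?C"
  proof (rule card_flip_half[where i = "p + k * bits + i"])
    show "finite ?C" using C(1) by simp
    fix xs assume xs: "xs \<in> ?C"
    then have len: "p + k * bits + i < length xs" using C(2) Suc.prems i(1) by simp
    have "hash_value bits (coin (flip (p + k * bits + i) xs)) p z k = hash_value bits (coin xs) p z k" for z
      by (rule hash_value_cong) (use len in \<open>simp add: coin_flip\<close>)
    then show "p + k * bits + i < length xs \<and> flip (p + k * bits + i) xs \<in> ?C"
      using xs C(3) len unfolding flip_closed_def by simp
    show "?P (flip (p + k * bits + i) xs) \<longleftrightarrow> \<not> ?P xs"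
      using parity_flip[OF i(1) len, of x] parity_flip[OF i(1) len, of y] i(2)
        par[of "coin xs" "p + k * bits" x] par[of "coin xs" "p + k * bits" y]
        par[of "coin (flip (p + k * bits + i) xs)" "p + k * bits" x]
        par[of "coin (flip (p + k * bits + i) xs)" "p + k * bits" y]
      by (metis not_mod_2_eq_1_eq_0 One_nat_def)
  qed
  moreover have "{xs \<in> C. hash_value bits (coin xs) p y (Suc k) = hash_value bits (coin xs) p x (Suc k)} =
      {xs \<in> ?C. ?P xs}"
  proof -
    have "2 * a + parity bits cs q y = 2 * b + parity bits cs q x \<longleftrightarrow>
        a = b \<and> parity bits cs q y = parity bits cs q x" for a b cs q
      using par[of cs q x] par[of cs q y] by presburger
    then show ?thesis by auto
  qed
  moreover have "2 ^ Suc k * card X = 2 ^ k * (2 * card X)" for X :: "bool list set" by simp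
  moreover have "2 ^ k * card ?C = card C" using Suc by simp
  ultimately show ?case by (simp only:)
qed simp

definition isolated :: "nat \<Rightarrow> nat \<Rightarrow> nat set \<Rightarrow> nat \<Rightarrow> (nat \<Rightarrow> nat) \<Rightarrow> nat \<Rightarrow> bool" where
  "isolated ell bits V x cs j \<longleftrightarrow>
     (\<forall>y\<in>V - {x}. hash_value bits cs (j * (ell * bits)) y ell \<noteq> hash_value bits cs (j * (ell * bits)) x ell)"

text \<open>\<open>A j\<close> collects the outcomes in which the first \<open>j\<close> repetitions
  fail. It ignores the coins of repetition \<open>j\<close>, hence each \<open>y\<close> collides
  with \<open>x\<close> there in exactly a fraction \<open>1 / 2 ^ ell\<close> of it. A union over
  \<open>y\<close> bounds the next failure by the factor \<open>card V / 2 ^ ell\<close>, and these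
  factors multiply.\<close>

lemma card_never_isolated:
  assumes V: "V \<subseteq> {..<2 ^ bits}" "x < 2 ^ bits" and K: "K = L * (ell * bits)"
  shows "2 ^ (ell * L) * card {xs. length xs = K \<and> (\<forall>j<L. \<not> isolated ell bits V x (coin xs) j)} \<le>
    card V ^ L * 2 ^ K"
proof -
  define A where "A j = {xs. length xs = K \<and> (\<forall>i<j. \<not> isolated ell bits V x (coin xs) i)}" for j
  have fin: "finite (A j)" for j
    by (rule finite_subset[OF _ finite_lists_length_eq[of "UNIV :: bool set" K]]) (auto simp: A_def)
  have finV: "finite V" using V(1) finite_subset by blast
  have "j \<le> L \<Longrightarrow> 2 ^ (ell * j) * card (A j) \<le> card V ^ j * 2 ^ K" for j
  proof (induction j)
    case 0
    have "card (A 0) = 2 ^ K"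
      using card_lists_length_eq[of "UNIV :: bool set" K] by (simp add: A_def)
    then show ?case by simp
  next
    case (Suc j)
    let ?p = "j * (ell * bits)"
    let ?c = "\<lambda>y. {xs \<in> A j. hash_value bits (coin xs) ?p y ell = hash_value bits (coin xs) ?p x ell}"
    have "Suc j * (ell * bits) \<le> K" unfolding K using Suc.prems by (intro mult_le_mono1)
    then have p: "?p + ell * bits \<le> K" by simp
    \<comment> \<open>The windows of all repetitions before \<open>j\<close> end at or before
      \<open>?p\<close>, so a flip from there on cannot change their verdicts.\<close>
    have cl: "flip_closed ?p (A j)"
      unfolding flip_closed_def
    proof (intro ballI allI impI)
      fix xs i assume xs: "xs \<in> A j" and i: "?p \<le> i" "i < length xs"
      have "isolated ell bits V x (coin (flip i xs)) l = isolated ell bits V x (coin xs) l" if "l < j" for l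
      proof -
        have "Suc l * (ell * bits) \<le> ?p" using that by (intro mult_le_mono1) simp
        then have "hash_value bits (coin (flip i xs)) (l * (ell * bits)) z ell = hash_value bits (coin xs) (l * (ell * bits)) z ell" for z
          by (intro hash_value_cong) (use i in \<open>simp add: coin_flip\<close>)
        then show ?thesis by (simp add: isolated_def)
      qed
      then show "flip i xs \<in> A j" using xs by (simp add: A_def)
    qed
    have "A (Suc j) \<subseteq> (\<Union>y\<in>V - {x}. ?c y)"
      by (auto simp: A_def isolated_def less_Suc_eq)
    then have "card (A (Suc j)) \<le> card (\<Union>y\<in>V - {x}. ?c y)"
      using finV fin by (intro card_mono) auto
    also have "\<dots> \<le> (\<Sum>y\<in>V - {x}. card (?c y))"
      using finV by (intro card_UN_le) simp
    finally have "2 ^ ell * card (A (Suc j)) \<le> (\<Sum>y\<in>V - {x}. 2 ^ ell * card (?c y))"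
      by (simp add: sum_distrib_left[symmetric])
    also have "\<dots> = (\<Sum>y\<in>V - {x}. card (A j))"
    proof (rule sum.cong[OF refl])
      fix y assume "y \<in> V - {x}"
      then have "y < 2 ^ bits" "x \<noteq> y" using V by auto
      then show "2 ^ ell * card (?c y) = card (A j)"
        by (intro card_collision[OF fin _ cl p V(2)]) (auto simp: A_def)
    qed
    also have "\<dots> \<le> card V * card (A j)" using finV by (simp add: card_mono)
    finally have "2 ^ (ell * j) * (2 ^ ell * card (A (Suc j))) \<le> card V * (2 ^ (ell * j) * card (A j))"
      by (simp add: mult.left_commute)
    also have "\<dots> \<le> card V * (card V ^ j * 2 ^ K)"
      using Suc by (intro mult_le_mono2) simp
    finally show ?case by (simp add: power_add mult.assoc mult.left_commute)
  qed
  from this[of L] show ?thesis by (simp add: A_def)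
qed

lemma card_never_isolated_half:
  assumes V: "V \<subseteq> {..<2 ^ bits}" "x < 2 ^ bits" "2 * card V \<le> 2 ^ ell" and K: "K = L * (ell * bits)"
  shows "2 ^ L * card {xs. length xs = K \<and> (\<forall>j<L. \<not> isolated ell bits V x (coin xs) j)} \<le> 2 ^ K"
    (is "_ * ?c \<le> _")
proof -
  have "2 ^ (ell * L) * (2 ^ L * ?c) \<le> 2 ^ L * (card V ^ L * 2 ^ K)"
    using card_never_isolated[OF V(1,2) K] by (simp add: mult.left_commute)
  also have "\<dots> = (2 * card V) ^ L * 2 ^ K" by (simp add: power_mult_distrib)
  also have "\<dots> \<le> (2 ^ ell) ^ L * 2 ^ K" using V(3) by (intro mult_le_mono1 power_mono) auto
  also have "\<dots> = 2 ^ (ell * L) * 2 ^ K" by (simp add: power_mult)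
  finally show ?thesis by simp
qed

section \<open>Probabilities of events determined by finitely many coins\<close>

lemma sets_coins: "{\<omega>. Q (stake K \<omega>)} \<in> sets coins"
proof -
  have "sets coins = sets (stream_space (count_space UNIV))"
    unfolding coins_def by (rule sets_stream_space_cong) simp
  moreover have "stake K -` {xs. Q xs} \<inter> space (stream_space (count_space UNIV)) \<in>
      sets (stream_space (count_space (UNIV :: bool set)))"
    by (rule measurable_sets[OF measurable_stake]) simp
  ultimately show ?thesis by (simp add: space_stream_space vimage_def)
qed

lemma prob_space_coins: "prob_space coins"
  unfolding coins_def by (rule prob_space.prob_space_stream_space) (rule prob_space_measure_pmf)

text \<open>The first \<open>K\<close> fair coins are uniform on bit lists of length
  \<open>K\<close>. The induction splits off the first coin, whose two values contribute half
  each.\<close>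

lemma emeasure_coins_stake:
  "emeasure coins {\<omega>. Q (stake K \<omega>)} = ennreal (card {xs. length xs = K \<and> Q xs} / 2 ^ K)"
proof (induction K arbitrary: Q)
  case 0
  have "{xs. length xs = 0 \<and> Q xs} = (if Q [] then {[]} else {})" by auto
  moreover have "space coins = UNIV" by (simp add: coins_def space_stream_space)
  ultimately show ?case using prob_space.emeasure_space_1[OF prob_space_coins] by auto
next
  case (Suc K)
  let ?c = "\<lambda>b. card {xs. length xs = K \<and> Q (b # xs)}"
  have fin: "finite {xs. length xs = K \<and> P xs}" for P :: "bool list \<Rightarrow> bool"
    by (rule finite_subset[OF _ finite_lists_length_eq[of "UNIV :: bool set" K]]) auto
  have "{xs. length xs = Suc K \<and> Q xs} = (\<lambda>xs. True # xs) ` {xs. length xs = K \<and> Q (True # xs)} \<union>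
      (\<lambda>xs. False # xs) ` {xs. length xs = K \<and> Q (False # xs)}"
    by (auto simp: length_Suc_conv image_iff) (metis (full_types))+
  then have c: "card {xs. length xs = Suc K \<and> Q xs} = ?c True + ?c False"
    using fin by (simp only:, subst card_Un_disjoint) (auto simp: card_image)
  have "emeasure coins {\<omega>. Q (stake (Suc K) \<omega>)} =
    (\<integral>\<^sup>+t. emeasure coins {\<omega>. Q (t # stake K \<omega>)} \<partial>measure_pmf (bernoulli_pmf (1 / 2)))"
    using sets_coins[of Q "Suc K"] unfolding coins_def
    by (subst prob_space.emeasure_stream_space[OF prob_space_measure_pmf]) (auto simp: space_stream_space)
  also have "\<dots> = (\<integral>\<^sup>+t. ennreal (?c t / 2 ^ K) \<partial>measure_pmf (bernoulli_pmf (1 / 2)))"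
    by (simp add: Suc.IH[of "\<lambda>xs. Q (_ # xs)"])
  also have "\<dots> = ennreal (?c True / 2 ^ K) / 2 + ennreal (?c False / 2 ^ K) / 2"
    by (simp add: nn_integral_bernoulli_pmf divide_ennreal_def)
  also have "\<dots> = ennreal (card {xs. length xs = Suc K \<and> Q xs} / 2 ^ Suc K)"
    unfolding c by (simp add: ennreal_divide_numeral ennreal_plus[symmetric] add_divide_distrib mult.commute
        del: ennreal_plus)
  finally show ?case .
qed

lemma measure_coins_stake:
  "measure coins {\<omega>. Q (stake K \<omega>)} = card {xs. length xs = K \<and> Q xs} / 2 ^ K"
  unfolding measure_def emeasure_coins_stake by simp

subsection \<open>Parameters\<close>

text \<open>The number of buckets is \<open>A n log\<^sup>2 n\<close> rounded up to a power of two,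
  with \<open>n\<close> and its logarithm already replaced by the roundings that the program has
  computed.\<close>

definition hash_bits :: "nat \<Rightarrow> nat \<Rightarrow> nat" where
  "hash_bits A n = ceillog2 (A * 2 ^ ceillog2 n * ceillog2 n * ceillog2 n)"

definition num_reps :: "nat \<Rightarrow> nat \<Rightarrow> nat" where
  "num_reps A' n = A' * ceillog2 n"

definition num_coins :: "nat \<Rightarrow> nat \<Rightarrow> nat \<Rightarrow> nat" where
  "num_coins A A' n = num_reps A' n * (hash_bits A n * (ceillog2 n + ceillog2 n))"

definition num_buckets :: "nat \<Rightarrow> nat \<Rightarrow> nat \<Rightarrow> nat" where
  "num_buckets A A' n = num_reps A' n * 2 ^ hash_bits A n"

definition space_bound :: "nat \<Rightarrow> nat \<Rightarrow> nat \<Rightarrow> nat" where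
  "space_bound A A' n = 64 + num_coins A A' n + 6 * num_buckets A A' n"

definition time_bound :: "nat \<Rightarrow> nat \<Rightarrow> nat \<Rightarrow> nat" where
  "time_bound A A' n = 5 * ceillog2 n + 5 * hash_bits A n + 6 * num_coins A A' n + 62 +
     num_reps A' n * (hash_bits A n * (9 * (ceillog2 n + ceillog2 n) + 11) + 78)"

lemma ceillog2_pos: "2 \<le> n \<Longrightarrow> 0 < ceillog2 n"
  using ceillog2_le_iff[of n 0] by (cases "ceillog2 n = 0") auto

lemma two_power_ceillog2: "0 < n \<Longrightarrow> n \<le> 2 ^ ceillog2 n"
  using ceillog2_le_iff[of n "ceillog2 n"] by simp

lemma two_power_ceillog2_less: "2 \<le> n \<Longrightarrow> 2 ^ ceillog2 n < 2 * n"
proof -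
  assume n: "2 \<le> n"
  then obtain k where k: "ceillog2 n = Suc k" using ceillog2_pos[OF n] gr0_implies_Suc by blast
  then have "2 ^ k < n" using ceillog2_le_iff[of n k] n by simp
  then show ?thesis by (simp add: k)
qed

lemma param_bounds:
  fixes A A' n :: nat
  assumes n: "2 \<le> n" and A: "2 \<le> A"
  defines "l \<equiv> ceillog2 n"
  shows "0 < hash_bits A n" "hash_bits A n \<le> (A + 3) * l"
    "num_coins A A' n \<le> 2 * A' * (A + 3) * l ^ 3"
    "num_buckets A A' n \<le> 4 * A * A' * n * l ^ 3"
    "A * n * l * l \<le> 2 ^ hash_bits A n"
proof -
  let ?t = "A * 2 ^ l * l * l"
  have l: "0 < l" unfolding l_def by (rule ceillog2_pos[OF n])
  have t: "2 \<le> ?t"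
  proof -
    have "2 * 1 * 1 * 1 \<le> ?t" using l A by (intro mult_le_mono) auto
    then show ?thesis by (simp only: mult_1_right)
  qed
  have h: "hash_bits A n = ceillog2 ?t" by (simp add: hash_bits_def l_def)
  show "0 < hash_bits A n" unfolding h by (rule ceillog2_pos[OF t])
  \<comment> \<open>A number is at most two to its own power; applied to \<open>A\<close> and to
    both factors \<open>l\<close>, this gives a bound on the logarithm that is linear in
    \<open>l\<close>.\<close>
  have "?t \<le> 2 ^ A * 2 ^ l * 2 ^ l * 2 ^ l"
    by (intro mult_le_mono) (auto intro: less_imp_le)
  also have "\<dots> = 2 ^ (A + 3 * l)" by (simp add: power_add[symmetric])
  finally have "hash_bits A n \<le> A + 3 * l"
    unfolding h using t by (subst ceillog2_le_iff) (auto intro: gr0I)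
  also have "\<dots> \<le> (A + 3) * l" using l by (simp add: add_mult_distrib)
  finally show hb: "hash_bits A n \<le> (A + 3) * l" .
  have "num_coins A A' n \<le> A' * l * ((A + 3) * l * (l + l))"
    unfolding num_coins_def num_reps_def l_def[symmetric] using hb by (intro mult_le_mono) auto
  also have "\<dots> = 2 * A' * (A + 3) * l ^ 3" by (simp add: power3_eq_cube algebra_simps)
  finally show "num_coins A A' n \<le> 2 * A' * (A + 3) * l ^ 3" .
  have "2 ^ hash_bits A n \<le> 2 * ?t" using two_power_ceillog2_less[OF t] h by simp
  also have "\<dots> \<le> 2 * (A * (2 * n) * l * l)"
    using two_power_ceillog2_less[OF n] by (intro mult_le_mono) (auto simp: l_def)
  finally have "num_buckets A A' n \<le> A' * l * (2 * (A * (2 * n) * l * l))"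
    unfolding num_buckets_def num_reps_def l_def[symmetric] by (intro mult_le_mono) auto
  also have "\<dots> = 4 * A * A' * n * l ^ 3" by (simp add: power3_eq_cube algebra_simps)
  finally show "num_buckets A A' n \<le> 4 * A * A' * n * l ^ 3" .
  have "A * n * l * l \<le> ?t"
    using two_power_ceillog2[of n] n by (intro mult_le_mono) (auto simp: l_def)
  also have "\<dots> \<le> 2 ^ hash_bits A n" unfolding h using l A by (intro two_power_ceillog2) simp
  finally show "A * n * l * l \<le> 2 ^ hash_bits A n" .
qed

lemma space_bound_le:
  assumes n: "2 \<le> n" and A: "2 \<le> A"
  shows "space_bound A A' n \<le> (64 + 2 * A' * (A + 3) + 24 * A * A') * n * ceillog2 n ^ 3"
proof -
  let ?l = "ceillog2 n ^ 3"
  have l: "1 \<le> ?l" using ceillog2_pos[OF n] by (simp add: Suc_leI)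
  have "num_coins A A' n \<le> 2 * A' * (A + 3) * ?l * n"
    using mult_le_mono[OF param_bounds(3)[OF n A, of A'], of 1 n] n by simp
  moreover have "64 \<le> 64 * n * ?l" using n l by (simp add: Suc_leI)
  ultimately have "space_bound A A' n \<le>
      64 * n * ?l + 2 * A' * (A + 3) * ?l * n + 6 * (4 * A * A' * n * ?l)"
    using param_bounds(4)[OF n A, of A'] unfolding space_bound_def by linarith
  also have "\<dots> = (64 + 2 * A' * (A + 3) + 24 * A * A') * n * ?l" by (simp add: algebra_simps)
  finally show ?thesis .
qed

lemma time_bound_le:
  assumes n: "2 \<le> n" and A: "2 \<le> A"
  shows "time_bound A A' n \<le>
    (67 + 5 * (A + 3) + 12 * A' * (A + 3) + A' * ((A + 3) * 29 + 78)) * ceillog2 n ^ 3"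
proof -
  define l where "l = ceillog2 n"
  have l: "1 \<le> l" using ceillog2_pos[OF n] by (simp add: l_def)
  have l3: "l \<le> l ^ 3" "1 \<le> l ^ 3" "l * l \<le> l ^ 3"
    using l by (simp_all add: power3_eq_cube)
  have hb: "hash_bits A n \<le> (A + 3) * l" using param_bounds(2)[OF n A] by (simp add: l_def)
  have "hash_bits A n * (9 * (l + l) + 11) + 78 \<le> (A + 3) * l * (29 * l) + 78 * (l * l)"
    using l hb by (intro add_mono mult_le_mono) auto
  also have "\<dots> = ((A + 3) * 29 + 78) * (l * l)" by (simp add: algebra_simps)
  finally have "num_reps A' n * (hash_bits A n * (9 * (l + l) + 11) + 78) \<le>
      A' * l * (((A + 3) * 29 + 78) * (l * l))"
    unfolding num_reps_def l_def[symmetric] by (intro mult_le_mono) auto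
  also have "\<dots> = A' * ((A + 3) * 29 + 78) * l ^ 3" by (simp add: power3_eq_cube algebra_simps)
  finally have 1: "num_reps A' n * (hash_bits A n * (9 * (l + l) + 11) + 78) \<le>
    A' * ((A + 3) * 29 + 78) * l ^ 3" .
  have 2: "5 * hash_bits A n \<le> 5 * (A + 3) * l ^ 3"
    using mult_le_mono2[OF hb, of 5] mult_le_mono2[OF l3(1), of "5 * (A + 3)"]
    by (simp only: mult.assoc)
  have 3: "6 * num_coins A A' n \<le> 12 * A' * (A + 3) * l ^ 3"
    using param_bounds(3)[OF n A, of A'] by (simp add: l_def)
  have "5 * l + 62 \<le> 67 * l ^ 3" using l3 by simp
  with 1 2 3 have "time_bound A A' n \<le> 67 * l ^ 3 + 5 * (A + 3) * l ^ 3 +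
      12 * A' * (A + 3) * l ^ 3 + A' * ((A + 3) * 29 + 78) * l ^ 3"
    unfolding time_bound_def l_def[symmetric] by linarith
  then show ?thesis unfolding l_def[symmetric] by (simp only: add_mult_distrib)
qed

lemma ceillog2_le_log: "2 \<le> n \<Longrightarrow> real (ceillog2 n) \<le> 2 * log 2 (real n)"
proof -
  assume n: "2 \<le> n"
  have "log 2 2 \<le> log 2 (real n)" using n by (subst log_le_cancel_iff) auto
  moreover have "log 2 2 = (1::real)" by simp
  moreover have "real (ceillog2 n) < log 2 (real n) + 1" using ceillog2_less_log[of n] n by simp
  ultimately show ?thesis by linarith
qed

text \<open>For \<open>n \<ge> 2\<close> the rounded logarithm is at most twice the real one, and
  the cube turns this 2 into the factor 8. The bound is uniform in \<epsilon>.\<close>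

lemma soft_O_ceillog2:
  assumes "\<And>n. 2 \<le> n \<Longrightarrow> f n \<le> C * g n * ceillog2 n ^ 3"
  shows "(\<lambda>_. f) \<in> soft_O (\<lambda>n. real (g n))"
  unfolding soft_O_def
proof (intro CollectI exI allI impI)
  fix \<epsilon> :: real and n :: nat assume n: "2 \<le> n"
  have "real (f n) \<le> real (C * g n * ceillog2 n ^ 3)" using assms[OF n] by linarith
  also have "\<dots> = real C * real (g n) * real (ceillog2 n) ^ 3" by simp
  also have "\<dots> \<le> real C * real (g n) * (2 * log 2 (real n)) ^ 3"
    using ceillog2_le_log[OF n] by (intro mult_left_mono power_mono) auto
  finally show "real (f n) \<le> (8 * real C) * real (g n) * log 2 (real n) ^ 3 * (1 / \<epsilon>) ^ 0"
    by (simp add: power_mult_distrib)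
qed

text \<open>Here \<open>\<kappa>\<close> is fixed. With \<open>C\<close> the constant of the space
  bound, all addresses are below \<open>2 ^ (C + 64 + 4 * l)\<close>, where one \<open>l\<close>
  comes from \<open>n\<close> and three from \<open>l ^ 3\<close>. The exponent is at most
  \<open>(C + 68) * l\<close>, and \<open>\<kappa> = C + 70\<close>. The bound also covers the
  fourth power of \<open>N\<close>.\<close>

lemma hash_layout_params:
  assumes n: "2 \<le> n" and A: "2 \<le> A" "0 < A'"
    and \<kappa>: "\<kappa> = 64 + 2 * A' * (A + 3) + 24 * A * A' + 70"
  shows "hash_layout (word_length \<kappa> n) (space_bound A A' n) (2 ^ ceillog2 n) (2 ^ hash_bits A n)
    (hash_bits A n) (num_reps A' n) (ceillog2 n + ceillog2 n) (num_coins A A' n) (num_buckets A A' n)"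
proof
  define l where "l = ceillog2 n"
  define C where "C = 64 + 2 * A' * (A + 3) + 24 * A * A'"
  have l: "0 < l" unfolding l_def by (rule ceillog2_pos[OF n])
  have w: "word_length \<kappa> n = \<kappa> * l" using n by (simp add: word_length_def l_def ceillog2_def)
  have "space_bound A A' n + 64 \<le> C * n * l ^ 3 + 64 * n * l ^ 3"
    using space_bound_le[OF n A(1), of A'] n l unfolding C_def l_def[symmetric]
    by (intro add_mono) (auto simp: Suc_leI)
  also have "\<dots> = (C + 64) * n * l ^ 3" by (simp add: algebra_simps)
  also have "\<dots> \<le> 2 ^ (C + 64) * 2 ^ l * (2 ^ l) ^ 3"
    using two_power_ceillog2[of n] n
    by (intro mult_le_mono power_mono) (auto simp: l_def intro: less_imp_le)
  also have "\<dots> = 2 ^ (C + 64 + 4 * l)" by (simp only: power_add[symmetric] power_mult[symmetric]) (simp add: mult.commute)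
  also have "\<dots> \<le> 2 ^ (\<kappa> * l)"
  proof (intro power_increasing)
    have "C + 64 + 4 * l \<le> (C + 64) * l + 4 * l" using l by simp
    also have "\<dots> \<le> \<kappa> * l" unfolding \<kappa> C_def by (simp add: add_mult_distrib)
    finally show "C + 64 + 4 * l \<le> \<kappa> * l" .
  qed simp
  finally show "space_bound A A' n + 64 \<le> 2 ^ word_length \<kappa> n" unfolding w .
  have "(2::nat) ^ (4 * l) < 2 ^ (\<kappa> * l)" using l \<kappa> by (intro power_strict_increasing) auto
  moreover have "(2::nat) ^ (4 * l) = 2 ^ l * 2 ^ l * (2 ^ l * 2 ^ l)"
    by (simp add: power_add[symmetric])
  ultimately show "2 ^ ceillog2 n * 2 ^ ceillog2 n * (2 ^ ceillog2 n * 2 ^ ceillog2 n) < (2::nat) ^ word_length \<kappa> n"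
    unfolding w l_def[symmetric] by (simp only:)
  show "space_bound A A' n = 64 + num_coins A A' n + 6 * num_buckets A A' n"
    by (rule space_bound_def)
  show "0 < (2::nat) ^ ceillog2 n" by simp
  show "(2::nat) ^ hash_bits A n = 2 ^ hash_bits A n" ..
  show "num_buckets A A' n = num_reps A' n * 2 ^ hash_bits A n" by (rule num_buckets_def)
  show "num_coins A A' n = num_reps A' n * (hash_bits A n * (ceillog2 n + ceillog2 n))"
    by (rule num_coins_def)
  show "0 < num_reps A' n" using l A by (simp add: num_reps_def l_def)
  show "0 < hash_bits A n" by (rule param_bounds(1)[OF n A(1)])
  show "2 ^ ceillog2 n * 2 ^ ceillog2 n \<le> (2::nat) ^ (ceillog2 n + ceillog2 n)"
    by (simp add: power_add)
qed

subsection \<open>Correctness on a stream\<close>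

text \<open>Minimum and maximum make the identifier independent of the order in which the stream
  names the end points, so a deletion may reverse the order of the insertion.\<close>

definition edge_id :: "nat \<Rightarrow> nat set \<Rightarrow> nat" where
  "edge_id N e = Min e * N + Max e"

definition id_edge :: "nat \<Rightarrow> nat \<Rightarrow> nat set" where
  "id_edge N y = {y div N, y mod N}"

definition edges_on :: "nat \<Rightarrow> nat set set" where
  "edges_on n = {{u, v} | u v. u < v \<and> v < n}"

lemma edge_id_doubleton: "edge_id N {u, v} = min u v * N + max u v"
  by (simp add: edge_id_def)

lemma id_edge_id: "e \<in> edges_on N \<Longrightarrow> id_edge N (edge_id N e) = e"
proof -
  assume "e \<in> edges_on N"
  then obtain u v where "e = {u, v}" "u < v" "v < N" unfolding edges_on_def by blast
  then show ?thesis by (simp add: id_edge_def edge_id_doubleton)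
qed

lemma inj_on_edge_id: "inj_on (edge_id N) (edges_on N)"
  by (rule inj_on_inverseI[where g = "id_edge N"]) (rule id_edge_id)

lemma doubleton_edges_on: "{u, v} \<in> edges_on n \<longleftrightarrow> u < n \<and> v < n \<and> u \<noteq> v"
proof
  assume "{u, v} \<in> edges_on n"
  then obtain a b where "{u, v} = {a, b}" "a < b" "b < n" unfolding edges_on_def by blast
  then show "u < n \<and> v < n \<and> u \<noteq> v" unfolding doubleton_eq_iff by auto
next
  assume *: "u < n \<and> v < n \<and> u \<noteq> v"
  show "{u, v} \<in> edges_on n"
  proof (cases "u < v")
    case True
    then show ?thesis using * unfolding edges_on_def by blast
  next
    case False
    then have "v < u" using * by simp
    then have "{v, u} \<in> edges_on n" using * unfolding edges_on_def by blast
    then show ?thesis by (simp add: insert_commute)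
  qed
qed

lemma edges_on_mono: "n \<le> N \<Longrightarrow> edges_on n \<subseteq> edges_on N"
  unfolding edges_on_def by (intro Collect_mono impI) (elim exE conjE, intro exI conjI, auto)

lemma graph_edges_on:
  assumes "legal_stream n T upd" "t \<le> T"
  shows "graph_edges upd t \<subseteq> edges_on n \<and> finite (graph_edges upd t)"
  using assms(2)
proof (induction t)
  case (Suc t)
  then have l: "legal_update n (graph_edges upd t) (upd t)"
    using assms(1) unfolding legal_stream_def by simp
  have IH: "graph_edges upd t \<subseteq> edges_on n" "finite (graph_edges upd t)" using Suc by simp_all
  show ?case
  proof (cases "upd t")
    case (Insert u v)
    then have "{u, v} \<in> edges_on n" using l by (simp add: doubleton_edges_on)
    then show ?thesis using IH Insert by simp
  next
    case (Delete u v)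
    then show ?thesis using IH by auto
  qed
qed simp

text \<open>Translates a legal update of the graph into the assumptions of \<open>wp_update\<close>.
  By injectivity of the identifiers, a new edge has a new identifier and a deletion removes exactly
  one.\<close>

lemma edge_id_update:
  fixes m m' :: "nat \<Rightarrow> nat" and N n x :: nat and E :: "nat set set" and V V' :: "nat set"
  assumes E: "E \<subseteq> edges_on N" and legal: "legal_update n E up" and n: "n \<le> N"
    and m': "m' = fst (feed up (m, \<omega>))"
    and x: "x = min (m' 2) (m' 3) * N + max (m' 2) (m' 3)"
    and V: "V = edge_id N ` E" and V': "V' = edge_id N ` apply_update up E"
  shows "m' 2 < N" "m' 3 < N" "if m' 1 = 0 then x \<in> V \<and> V' = V - {x} else x \<notin> V \<and> V' = insert x V"
proof -
  have inj: "edge_id N e = edge_id N f \<longleftrightarrow> e = f" if "e \<in> edges_on N" "f \<in> edges_on N" for e f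
    using inj_on_eq_iff[OF inj_on_edge_id that] .
  have x': "x = edge_id N {m' 2, m' 3}" by (simp add: x edge_id_doubleton)
  have *: "m' 2 < N \<and> m' 3 < N \<and> (if m' 1 = 0 then x \<in> V \<and> V' = V - {x} else x \<notin> V \<and> V' = insert x V)"
  proof (cases up)
    case (Insert u v)
    then have e: "{u, v} \<in> edges_on N" "{u, v} \<notin> E" "u < N" "v < N"
      using legal n by (simp_all add: doubleton_edges_on)
    have "edge_id N {u, v} \<notin> edge_id N ` E"
      using inj[OF e(1)] e(2) E by blast
    then show ?thesis using Insert e unfolding x' V V' m' by simp
  next
    case (Delete u v)
    then have e: "{u, v} \<in> E" using legal by simp
    then have "{u, v} \<in> edges_on N" using E by blast
    then have "u < N" "v < N" by (simp_all add: doubleton_edges_on)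
    moreover have "edge_id N ` (E - {{u, v}}) = edge_id N ` E - edge_id N ` {{u, v}}"
      using e E by (intro inj_on_image_set_diff[OF inj_on_edge_id]) auto
    ultimately show ?thesis using Delete e unfolding x' V V' m' by simp
  qed
  then show "m' 2 < N" "m' 3 < N" by auto
  show "if m' 1 = 0 then x \<in> V \<and> V' = V - {x} else x \<notin> V \<and> V' = insert x V"
    using * by blast
qed

text \<open>The output as a function of coins and identifiers, without reference to the machine; it
  links the execution to the counting argument.\<close>

definition recovered :: "nat \<Rightarrow> nat \<Rightarrow> nat \<Rightarrow> (nat \<Rightarrow> nat) \<Rightarrow> nat set \<Rightarrow> nat set" where
  "recovered L ell bits cs V = {y \<in> V. \<exists>j<L. isolated ell bits V y cs j}"

lemma recovered_cong:
  assumes "\<And>i. i < L * (ell * bits) \<Longrightarrow> cs i = cs' i"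
  shows "recovered L ell bits cs V = recovered L ell bits cs' V"
proof -
  have "isolated ell bits V y cs j = isolated ell bits V y cs' j" if "j < L" for y j
  proof -
    have "Suc j * (ell * bits) \<le> L * (ell * bits)" using that by (intro mult_le_mono1) simp
    then have "hash_value bits cs (j * (ell * bits)) z ell = hash_value bits cs' (j * (ell * bits)) z ell" for z
      by (intro hash_value_cong assms) simp
    then show ?thesis by (simp add: isolated_def)
  qed
  then show ?thesis unfolding recovered_def by blast
qed

lemma (in hash_layout) singleton_buckets:
  "{y. \<exists>q<R. bucket cs V q = {y}} = recovered L ell bits cs V"
proof (intro set_eqI iffI)
  fix y assume "y \<in> {y. \<exists>q<R. bucket cs V q = {y}}"
  then obtain q where q: "q < R" "bucket cs V q = {y}" by blast
  have "q div B < L" using q(1) by (simp add: R_eq less_mult_imp_div_less)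
  moreover have y: "y \<in> V" "hash_value bits cs (q div B * (ell * bits)) y ell = q mod B"
    using q(2) by (auto simp: bucket_def)
  moreover have "isolated ell bits V y cs (q div B)"
    unfolding isolated_def using q(2) y(2) by (auto simp: bucket_def)
  ultimately show "y \<in> recovered L ell bits cs V" by (auto simp: recovered_def)
next
  fix y assume "y \<in> recovered L ell bits cs V"
  then obtain j where j: "y \<in> V" "j < L" "isolated ell bits V y cs j" by (auto simp: recovered_def)
  define h where "h = hash_value bits cs (j * (ell * bits)) y ell"
  have h: "h < B" unfolding h_def B_eq by (rule hash_value_less)
  have "Suc j * B \<le> L * B" using j by (intro mult_le_mono1) simp
  then have "j * B + h < R" using h by (simp add: R_eq)
  moreover have "bucket cs V (j * B + h) = {y}"
    using h j by (auto simp: bucket_def h_def isolated_def)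
  ultimately show "y \<in> {y. \<exists>q<R. bucket cs V q = {y}}" by blast
qed

text \<open>The union bound runs over all pairs of a time step in \<open>G\<close> and a present
  identifier, at most \<open>(T + 1) * 2 ^ bits\<close> of them. The sets \<open>V t\<close> are
  fixed before the coins are tossed.\<close>

lemma recovered_probability:
  fixes V :: "nat \<Rightarrow> nat set"
  assumes G: "G \<subseteq> {..T}" and V: "\<And>t. t \<in> G \<Longrightarrow> V t \<subseteq> {..<2 ^ bits} \<and> 2 * card (V t) \<le> 2 ^ ell"
    and K: "K = L * (ell * bits)"
  shows "1 - real (T + 1) * 2 ^ bits / 2 ^ L \<le>
    real (card {xs. length xs = K \<and> (\<forall>t\<in>G. recovered L ell bits (coin xs) (V t) = V t)}) / 2 ^ K"
proof -
  let ?good = "{xs. length xs = K \<and> (\<forall>t\<in>G. recovered L ell bits (coin xs) (V t) = V t)}"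
  let ?bad = "\<lambda>t x. {xs. length xs = K \<and> (\<forall>j<L. \<not> isolated ell bits (V t) x (coin xs) j)}"
  let ?all = "{xs :: bool list. length xs = K}"
  have finG: "finite G" using G finite_subset by blast
  have finV: "finite (V t)" if "t \<in> G" for t using V[OF that] finite_subset by blast
  have all: "finite ?all" "card ?all = 2 ^ K"
    using finite_lists_length_eq[of "UNIV :: bool set" K] card_lists_length_eq[of "UNIV :: bool set" K]
    by simp_all
  have fin: "finite (?bad t x)" for t x by (rule finite_subset[OF _ all(1)]) auto
  have "?all - ?good \<subseteq> (\<Union>t\<in>G. \<Union>x\<in>V t. ?bad t x)"
    by (auto simp: recovered_def)
  then have "card (?all - ?good) \<le> card (\<Union>t\<in>G. \<Union>x\<in>V t. ?bad t x)"
    using finG finV fin by (intro card_mono) auto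
  also have "\<dots> \<le> (\<Sum>t\<in>G. card (\<Union>x\<in>V t. ?bad t x))" by (rule card_UN_le[OF finG])
  also have "\<dots> \<le> (\<Sum>t\<in>G. \<Sum>x\<in>V t. card (?bad t x))"
    by (intro sum_mono card_UN_le finV)
  finally have "2 ^ L * card (?all - ?good) \<le> (\<Sum>t\<in>G. \<Sum>x\<in>V t. 2 ^ L * card (?bad t x))"
    by (simp add: sum_distrib_left[symmetric])
  also have "\<dots> \<le> (\<Sum>t\<in>G. \<Sum>x\<in>V t. 2 ^ K)"
    using V by (intro sum_mono card_never_isolated_half[OF _ _ _ K]) auto
  also have "\<dots> = (\<Sum>t\<in>G. card (V t) * 2 ^ K)" by simp
  also have "\<dots> \<le> (\<Sum>t\<in>{..T}. 2 ^ bits * 2 ^ K)"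
  proof (rule order_trans[OF sum_mono sum_mono2])
    show "card (V t) * 2 ^ K \<le> 2 ^ bits * 2 ^ K" if "t \<in> G" for t
      using card_mono[of "{..<2 ^ bits}" "V t"] V[OF that] by simp
  qed (use G in auto)
  finally have bad: "2 ^ L * card (?all - ?good) \<le> (T + 1) * 2 ^ bits * 2 ^ K"
    by (simp add: algebra_simps)
  have "card ?all = card ?good + card (?all - ?good)"
    using all(1) by (subst card_Un_disjoint[symmetric]) (auto intro: arg_cong[where f = card] finite_subset[OF _ all(1)])
  then have "2 ^ L * 2 ^ K \<le> 2 ^ L * card ?good + (T + 1) * 2 ^ bits * 2 ^ K"
    using bad by (simp add: all(2) distrib_left)
  then have "real (2 ^ L * 2 ^ K) \<le> real (2 ^ L * card ?good + (T + 1) * 2 ^ bits * 2 ^ K)"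
    by (simp only: of_nat_le_iff)
  then have "(2::real) ^ L * 2 ^ K \<le> 2 ^ L * real (card ?good) + real (T + 1) * 2 ^ bits * 2 ^ K"
    by (simp add: algebra_simps)
  then show ?thesis by (simp add: field_simps)
qed

text \<open>Counting powers of \<open>n\<close>: \<open>T + 1\<close> is at most \<open>n\<close> to
  the power \<open>lam + 1\<close>, the number of identifiers is at most \<open>n ^ 4\<close>
  because \<open>2 ^ ceillog2 n \<le> 2 * n \<le> n * n\<close>, and
  \<open>2 ^ num_reps A' n\<close> is at least \<open>n ^ A'\<close>. So
  \<open>A' \<ge> lam + d + 6\<close> leaves one power to spare.\<close>

lemma failure_bound:
  fixes lam d :: real
  assumes n: "2 \<le> n" and lam: "1 \<le> lam" and T: "T = nat \<lceil>real n powr lam\<rceil>"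
    and A': "lam + d + 6 \<le> real A'"
  shows "real (T + 1) * 2 ^ (ceillog2 n + ceillog2 n) / 2 ^ num_reps A' n \<le> 1 / real n powr d"
proof -
  have n2: "2 \<le> real n" using n by simp
  have lam': "2 powr 1 \<le> real n powr lam"
    using n2 lam by (intro powr_mono_both) auto
  then have "0 \<le> \<lceil>real n powr lam\<rceil>" by simp
  then have "real T = of_int \<lceil>real n powr lam\<rceil>" unfolding T by simp
  then have "real T \<le> real n powr lam + 1" by linarith
  then have "real (T + 1) \<le> 2 * real n powr lam" using lam' by simp
  also have "\<dots> \<le> real n * real n powr lam" using n2 by (intro mult_right_mono) auto
  finally have 1: "real (T + 1) \<le> real n * real n powr lam" .
  have "(2::real) ^ ceillog2 n \<le> 2 * real n"
    using two_power_ceillog2_less[OF n] by (metis less_imp_le of_nat_le_iff of_nat_mult of_nat_numeral of_nat_power)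
  also have "\<dots> \<le> real n * real n" using n2 by (intro mult_right_mono) auto
  finally have "(2::real) ^ ceillog2 n * 2 ^ ceillog2 n \<le> (real n * real n) * (real n * real n)"
    by (intro mult_mono) auto
  then have 2: "(2::real) ^ (ceillog2 n + ceillog2 n) \<le> real n ^ 4"
    by (simp add: power_add power4_eq_xxxx mult.assoc)
  have "real n \<le> 2 ^ ceillog2 n"
    using two_power_ceillog2[of n] n by (metis gr0I not_numeral_le_zero of_nat_le_iff of_nat_numeral of_nat_power)
  then have "real n ^ A' \<le> (2 ^ ceillog2 n) ^ A'" by (intro power_mono) auto
  then have 3: "real n ^ A' \<le> 2 ^ num_reps A' n"
    by (simp add: num_reps_def power_mult[symmetric] mult.commute)
  have "real (T + 1) * 2 ^ (ceillog2 n + ceillog2 n) / 2 ^ num_reps A' n \<le>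
      (real n * real n powr lam) * real n ^ 4 / real n ^ A'"
    using 1 2 3 n2 by (intro frac_le mult_mono) auto
  also have "\<dots> = real n powr (1 + lam + 4 - A')"
    using n2 by (simp add: powr_add powr_diff powr_realpow) (simp add: eval_nat_numeral)
  also have "\<dots> \<le> real n powr (- d)" using n2 A' by (intro powr_mono) auto
  also have "\<dots> = 1 / real n powr d" using n2 by (simp add: powr_minus_divide)
  finally show ?thesis .
qed

section \<open>From single updates to whole streams\<close>

lemma stream_run:
  fixes V :: "nat \<Rightarrow> nat set"
  assumes n: "2 \<le> n" and A: "2 \<le> A" "0 < A'"
    and \<kappa>: "\<kappa> = 64 + 2 * A' * (A + 3) + 24 * A * A' + 70"
    and legal: "legal_stream n T upd"
    and V: "\<And>t. V t = edge_id (2 ^ ceillog2 n) ` graph_edges upd t"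
  obtains st where
    "is_run (word_length \<kappa> n) (space_bound A A' n) (time_bound A A' n) (main_prog A A') n T upd \<omega> st"
    "\<And>t. t \<le> T \<Longrightarrow> stored_within (space_bound A A' n) (st t)"
    "\<And>t. t \<le> T \<Longrightarrow> stored_edges (st t) = id_edge (2 ^ ceillog2 n) `
       recovered (num_reps A' n) (hash_bits A n) (ceillog2 n + ceillog2 n) (\<lambda>i. of_bool (\<omega> !! i)) (V t)"
proof -
  define N :: nat where "N = 2 ^ ceillog2 n"
  interpret hash_layout "word_length \<kappa> n" "space_bound A A' n" N "2 ^ hash_bits A n"
    "hash_bits A n" "num_reps A' n" "ceillog2 n + ceillog2 n" "num_coins A A' n" "num_buckets A A' n"
    unfolding N_def by (rule hash_layout_params[OF n A \<kappa>])
  let ?w = "word_length \<kappa> n" and ?S = "space_bound A A' n" and ?p = "main_prog A A'"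
  let ?\<tau> = "time_bound A A' n" and ?cs = "\<lambda>i. of_bool (\<omega> !! i) :: nat"
  \<comment> \<open>The successor state is chosen among the executions within the time bound. As
    execution is deterministic, it is the state about which \<open>wp_main\<close> speaks.\<close>
  define st where "st = rec_nat (initial_state n \<omega>)
    (\<lambda>t s. SOME s'. \<exists>k\<le>?\<tau>. exec ?w ?S ?p (feed (upd t) s) k s')"
  define J where "J t s \<longleftrightarrow> fst s 6 = 1 \<and> sketch ?cs (V t) (fst s) \<or> t = 0 \<and> s = initial_state n \<omega>" for t s
  have nN: "n \<le> N" unfolding N_def using two_power_ceillog2[of n] n by simp
  have E: "graph_edges upd t \<subseteq> edges_on N" if "t \<le> T" for t
    using graph_edges_on[OF legal that] edges_on_mono[OF nN] by blast
  have step: "\<exists>k\<le>?\<tau>. \<exists>s'. exec ?w ?S ?p (feed (upd t) s) k s' \<and> J (Suc t) s'" if t: "t < T" and J: "J t s" for t s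
  proof -
    obtain m \<omega>' where s: "s = (m, \<omega>')" by (cases s)
    define m' where "m' = fst (feed (upd t) (m, \<omega>'))"
    have f: "feed (upd t) s = (m', \<omega>')" unfolding s m'_def by (cases "upd t") simp_all
    have m': "m' = m(1 := m' 1, 2 := m' 2, 3 := m' 3)" unfolding m'_def by (cases "upd t") auto
    have fr: "m' a = m a" if "a \<notin> {1, 2, 3}" for a
      using that by (subst m') simp
    define x where "x = min (m' 2) (m' 3) * N + max (m' 2) (m' 3)"
    have V': "V (Suc t) = edge_id N ` apply_update (upd t) (graph_edges upd t)"
      unfolding V N_def by simp
    have l: "legal_update n (graph_edges upd t) (upd t)" using legal t by (simp add: legal_stream_def)
    note u = edge_id_update[OF E[OF less_imp_le[OF t]] l nN m'_def x_def V[folded N_def] V']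
    \<comment> \<open>Before the first update no coin has been tossed, so the remaining coins are
      all of \<omega>, and \<open>?cs\<close> describes the stored coins at every later
      step.\<close>
    have "m' 6 = 1 \<and> sketch ?cs (V t) m' \<or>
      m' 0 = n \<and> (\<forall>a\<ge>4. m' a = 0) \<and> V t = {} \<and> ?cs = (\<lambda>i. of_bool (\<omega>' !! i))"
    proof (cases "t = 0 \<and> s = initial_state n \<omega>")
      case True
      then have "m = (\<lambda>_. 0)(0 := n)" "\<omega>' = \<omega>" using s by (auto simp: initial_state_def)
      then show ?thesis using fr True by (simp add: V)
    next
      case False
      then have "m 6 = 1" "sketch ?cs (V t) m" using J by (auto simp: J_def s)
      moreover have "agree_except {1, 2, 3} m m'" using fr by (simp add: agree_except_def)
      ultimately have "sketch ?cs (V t) m'" "m' 6 = 1"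
        using agree_except_regs[of "{1, 2, 3}" m m'] fr
        by (auto simp: sketch_def has_coins_def table_def)
      then show ?thesis by simp
    qed
    from wp_main[OF n A refl N_def _ num_reps_def refl this u(1,2) x_def u(3)]
    have "wp ?w ?S ?p (\<lambda>k m'' \<omega>''. k \<le> ?\<tau> \<and> m'' 6 = 1 \<and> sketch ?cs (V (Suc t)) m'') m' \<omega>'"
      by (simp add: hash_bits_def N_def time_bound_def)
    then show ?thesis unfolding wp_def f J_def by (metis fst_conv)
  qed
  have run: "t \<le> T \<Longrightarrow> J t (st t)" "t < T \<Longrightarrow> \<exists>k\<le>?\<tau>. exec ?w ?S ?p (feed (upd t) (st t)) k (st (Suc t))" for t
  proof -
    have next_state: "(\<exists>k\<le>?\<tau>. exec ?w ?S ?p (feed (upd t) (st t)) k (st (Suc t))) \<and> J (Suc t) (st (Suc t))"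
      if t: "t < T" and J: "J t (st t)" for t
    proof -
      have eq: "st (Suc t) = (SOME s'. \<exists>k\<le>?\<tau>. exec ?w ?S ?p (feed (upd t) (st t)) k s')"
        by (simp add: st_def)
      from step[OF t J] obtain k s' where k: "k \<le> ?\<tau>" "exec ?w ?S ?p (feed (upd t) (st t)) k s'" "J (Suc t) s'"
        by blast
      have "\<exists>s'. \<exists>k\<le>?\<tau>. exec ?w ?S ?p (feed (upd t) (st t)) k s'" using k by blast
      then have ex: "\<exists>k\<le>?\<tau>. exec ?w ?S ?p (feed (upd t) (st t)) k (st (Suc t))"
        unfolding eq by (rule someI_ex)
      then have "st (Suc t) = s'" using k(2) exec_deterministic by blast
      then show ?thesis using ex k(3) by simp
    qed
    have J: "t \<le> T \<Longrightarrow> J t (st t)" for t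
    proof (induction t)
      case 0
      show ?case by (simp add: J_def st_def)
    next
      case (Suc t)
      then show ?case using next_state by simp
    qed
    then show "t \<le> T \<Longrightarrow> J t (st t)" .
    show "t < T \<Longrightarrow> \<exists>k\<le>?\<tau>. exec ?w ?S ?p (feed (upd t) (st t)) k (st (Suc t))"
      using next_state J by simp
  qed
  have out: "stored_within ?S (st t) \<and> stored_edges (st t) = id_edge N `
       recovered (num_reps A' n) (hash_bits A n) (ceillog2 n + ceillog2 n) ?cs (V t)" if "t \<le> T" for t
  \<comment> \<open>Before any update the memory is not initialized, but length and start address
    are zero, which is a valid empty list.\<close>
  proof (cases "t = 0 \<and> st t = initial_state n \<omega>")
    case True
    then have "t = 0" "st 0 = initial_state n \<omega>" by auto
    then show ?thesis
      by (simp add: initial_state_def stored_within_def stored_edges_def V recovered_def)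
  next
    case False
    then have s: "sketch ?cs (V t) (fst (st t))" using run(1)[OF that] by (auto simp: J_def)
    have "{{y div N, y mod N} | y. \<exists>q<num_buckets A A' n. bucket ?cs (V t) q = {y}} =
        id_edge N ` {y. \<exists>q<num_buckets A A' n. bucket ?cs (V t) q = {y}}"
      by (auto simp: id_edge_def)
    then show ?thesis
      using sketch_stored[OF s, of "snd (st t)"] by (simp add: singleton_buckets)
  qed
  show ?thesis
  proof (rule that)
    show "is_run ?w ?S ?\<tau> ?p n T upd \<omega> st"
      unfolding is_run_def using run(2) by (simp add: st_def)
  qed (use out in \<open>simp_all add: N_def\<close>)
qed

lemma stream_success:
  fixes A A' n T :: nat and cs c d \<alpha> lam :: real
  assumes n: "2 \<le> n" and A: "2 \<le> A" "0 < A'"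
    and \<alpha>: "16 * \<alpha> * c\<^sup>2 \<le> real A"
    and A': "lam + d + 6 \<le> real A'" and lam: "1 \<le> lam" and T: "T = nat \<lceil>real n powr lam\<rceil>"
    and legal: "legal_stream n T upd"
    and st: "\<And>\<omega> t. t \<le> T \<Longrightarrow> stored_edges (st \<omega> t) = id_edge (2 ^ ceillog2 n) `
       recovered (num_reps A' n) (hash_bits A n) (ceillog2 n + ceillog2 n) (\<lambda>i. of_bool (\<omega> !! i))
       (edge_id (2 ^ ceillog2 n) ` graph_edges upd t)"
  shows "1 - 1 / real n powr d \<le> measure coins {\<omega>. \<forall>t\<le>T.
      real (card (graph_edges upd t)) \<le> 8 * \<alpha> * c\<^sup>2 * real n * (log 2 (real n))\<^sup>2 \<longrightarrow>
      stored_edges (st \<omega> t) = graph_edges upd t}"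
proof -
  define N :: nat where "N = 2 ^ ceillog2 n"
  define V :: "nat \<Rightarrow> nat set" where "V t = edge_id N ` graph_edges upd t" for t
  define G :: "nat set" where "G = {t. t \<le> T \<and>
    real (card (graph_edges upd t)) \<le> 8 * \<alpha> * c\<^sup>2 * real n * (log 2 (real n))\<^sup>2}"
  let ?L = "num_reps A' n" and ?h = "hash_bits A n" and ?b = "ceillog2 n + ceillog2 n"
  let ?K = "num_coins A A' n"
  define rec where "rec xs t = id_edge N ` recovered ?L ?h ?b (coin xs) (V t)" for xs t
  have nN: "n \<le> N" unfolding N_def using two_power_ceillog2[of n] n by simp
  have E: "graph_edges upd t \<subseteq> edges_on N" "finite (graph_edges upd t)" if "t \<le> T" for t
    using graph_edges_on[OF legal that] edges_on_mono[OF nN] by auto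
  have rec: "stored_edges (st \<omega> t) = rec (stake ?K \<omega>) t" if "t \<le> T" for \<omega> t
  proof -
    have "recovered ?L ?h ?b (\<lambda>i. of_bool (\<omega> !! i)) (V t) = recovered ?L ?h ?b (coin (stake ?K \<omega>)) (V t)"
      by (rule recovered_cong) (simp add: coin_def num_coins_def)
    then show ?thesis unfolding rec_def st[OF that] V_def N_def by simp
  qed
  \<comment> \<open>The success event depends on a finite prefix of the coins, so its probability is
    a proportion of bit lists.\<close>
  have "{\<omega>. \<forall>t\<le>T. real (card (graph_edges upd t)) \<le> 8 * \<alpha> * c\<^sup>2 * real n * (log 2 (real n))\<^sup>2 \<longrightarrow>
      stored_edges (st \<omega> t) = graph_edges upd t} =
    {\<omega>. (\<lambda>xs. \<forall>t\<in>G. rec xs t = graph_edges upd t) (stake ?K \<omega>)}"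
    using rec by (auto simp: G_def)
  then have "measure coins {\<omega>. \<forall>t\<le>T.
      real (card (graph_edges upd t)) \<le> 8 * \<alpha> * c\<^sup>2 * real n * (log 2 (real n))\<^sup>2 \<longrightarrow>
      stored_edges (st \<omega> t) = graph_edges upd t} =
    real (card {xs. length xs = ?K \<and> (\<forall>t\<in>G. rec xs t = graph_edges upd t)}) / 2 ^ ?K"
    using measure_coins_stake[of "\<lambda>xs. \<forall>t\<in>G. rec xs t = graph_edges upd t" ?K] by simp
  \<comment> \<open>Recovering all identifiers implies the correct edge set after decoding; only
    this inclusion of events is needed.\<close>
  also have "\<dots> \<ge> real (card {xs. length xs = ?K \<and> (\<forall>t\<in>G. recovered ?L ?h ?b (coin xs) (V t) = V t)}) / 2 ^ ?K"
  proof (intro divide_right_mono of_nat_mono card_mono)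
    show "finite {xs. length xs = ?K \<and> (\<forall>t\<in>G. rec xs t = graph_edges upd t)}"
      by (rule finite_subset[OF _ finite_lists_length_eq[of "UNIV :: bool set" ?K]]) auto
    have "id_edge N ` V t = graph_edges upd t" if "t \<in> G" for t
    proof -
      have "e \<in> edges_on N" if "e \<in> graph_edges upd t" for e
        using that \<open>t \<in> G\<close> E(1)[of t] by (auto simp: G_def)
      then show ?thesis unfolding V_def by (simp add: image_image id_edge_id cong: image_cong)
    qed
    then show "{xs. length xs = ?K \<and> (\<forall>t\<in>G. recovered ?L ?h ?b (coin xs) (V t) = V t)} \<subseteq>
      {xs. length xs = ?K \<and> (\<forall>t\<in>G. rec xs t = graph_edges upd t)}"
      by (intro Collect_mono impI) (simp add: rec_def)
  qed simp
  finally have 1: "real (card {xs. length xs = ?K \<and> (\<forall>t\<in>G. recovered ?L ?h ?b (coin xs) (V t) = V t)}) / 2 ^ ?K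
    \<le> measure coins {\<omega>. \<forall>t\<le>T.
      real (card (graph_edges upd t)) \<le> 8 * \<alpha> * c\<^sup>2 * real n * (log 2 (real n))\<^sup>2 \<longrightarrow>
      stored_edges (st \<omega> t) = graph_edges upd t}" .
  have "V t \<subseteq> {..<2 ^ ?b} \<and> 2 * card (V t) \<le> 2 ^ ?h" if t: "t \<in> G" for t
  proof
    have tT: "t \<le> T" using t by (simp add: G_def)
    show "V t \<subseteq> {..<2 ^ ?b}"
    proof
      fix y assume "y \<in> V t"
      then obtain e where e: "e \<in> edges_on N" "y = edge_id N e" using E(1)[OF tT] by (auto simp: V_def)
      then obtain u v where uv: "e = {u, v}" "u < v" "v < N" by (auto simp: edges_on_def)
      then have "y = u * N + v" using e(2) by (simp add: edge_id_doubleton)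
      also have "\<dots> < Suc u * N" using uv by simp
      also have "\<dots> \<le> N * N" using uv by (intro mult_le_mono1) simp
      finally show "y \<in> {..<2 ^ ?b}" by (simp add: N_def power_add)
    qed
    have log: "0 \<le> log 2 (real n)" "log 2 (real n) \<le> real (ceillog2 n)"
      using n ceillog2_ge_log[of n] by simp_all
    have "real (card (V t)) \<le> real (card (graph_edges upd t))"
      unfolding V_def using card_image_le[OF E(2)[OF tT]] by simp
    also have "\<dots> \<le> 8 * \<alpha> * c\<^sup>2 * real n * (log 2 (real n))\<^sup>2" using t by (simp add: G_def)
    finally have "real (2 * card (V t)) \<le> (16 * \<alpha> * c\<^sup>2) * (real n * (log 2 (real n))\<^sup>2)"
      by (simp add: mult.assoc mult.left_commute)
    also have "\<dots> \<le> real A * (real n * (real (ceillog2 n))\<^sup>2)"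
      using \<alpha> log by (intro mult_mono power_mono) auto
    also have "\<dots> = real (A * n * ceillog2 n * ceillog2 n)" by (simp add: power2_eq_square)
    also have "\<dots> \<le> real (2 ^ ?h)" using param_bounds(5)[OF n A(1)] by (simp only: of_nat_le_iff)
    finally show "2 * card (V t) \<le> 2 ^ ?h" by (simp only: of_nat_le_iff)
  qed
  then have "1 - real (T + 1) * 2 ^ ?b / 2 ^ ?L \<le>
    real (card {xs. length xs = ?K \<and> (\<forall>t\<in>G. recovered ?L ?h ?b (coin xs) (V t) = V t)}) / 2 ^ ?K"
    by (intro recovered_probability) (auto simp: G_def num_coins_def)
  then show ?thesis using failure_bound[OF n lam T A'] 1 by linarith
qed

theorem theorem5p2:
  fixes cs lam c d :: real
  assumes "lam \<ge> 1" and "c > lam" and "d > 0"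
  shows "\<exists>(\<kappa>::nat) (S :: real \<Rightarrow> nat \<Rightarrow> nat) (\<tau> :: real \<Rightarrow> nat \<Rightarrow> nat).
    S \<in> soft_O (\<lambda>n. real n) \<and> \<tau> \<in> soft_O (\<lambda>_. 1) \<and>
    (\<forall>\<epsilon>::real. 0 < \<epsilon> \<longrightarrow> \<epsilon> < 1 \<longrightarrow> (\<exists>p::prog. \<forall>n::nat. n \<ge> 2 \<longrightarrow>
      (let \<alpha> = 2 + cs * \<epsilon>; T = nat \<lceil>real n powr lam\<rceil> in
       \<forall>upd. legal_stream n T upd \<longrightarrow>
         (\<exists>st :: bool stream \<Rightarrow> nat \<Rightarrow> state.
           (\<forall>\<omega>. is_run (word_length \<kappa> n) (S \<epsilon> n) (\<tau> \<epsilon> n) p n T upd \<omega> (st \<omega>) \<and>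
             (\<forall>t\<le>T. stored_within (S \<epsilon> n) (st \<omega> t) \<and>
                stored_edges (st \<omega> t) \<subseteq> graph_edges upd t)) \<and>
           measure coins {\<omega>. \<forall>t\<le>T.
             real (card (graph_edges upd t)) \<le> 8 * \<alpha> * c\<^sup>2 * real n * (log 2 (real n))\<^sup>2 \<longrightarrow>
             stored_edges (st \<omega> t) = graph_edges upd t} \<ge> 1 - 1 / real n powr d))))"
proof -
  \<comment> \<open>The 16 is the 8 of the edge bound times the 2 that makes the buckets at least
    twice as many as the edges. With the absolute value of \<open>cs\<close> the bound holds for all
    \<epsilon> below 1 and either sign, so a single program works for every \<epsilon>. The added 2
    makes \<open>2 \<le> A\<close> immediate.\<close>
  define A where "A = nat \<lceil>16 * (2 + \<bar>cs\<bar>) * c\<^sup>2\<rceil> + 2"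
  define A' where "A' = nat \<lceil>lam + d + 6\<rceil>"
  define \<kappa> where "\<kappa> = 64 + 2 * A' * (A + 3) + 24 * A * A' + 70"
  have A: "2 \<le> A" "16 * (2 + \<bar>cs\<bar>) * c\<^sup>2 \<le> real A" unfolding A_def by linarith+
  have A': "lam + d + 6 \<le> real A'" "0 < A'" unfolding A'_def using assms by linarith+
  have S: "(\<lambda>_. space_bound A A') \<in> soft_O (\<lambda>n. real n)"
    by (rule soft_O_ceillog2[where g = "\<lambda>n. n"]) (rule space_bound_le[OF _ A(1)])
  have "(\<lambda>_. time_bound A A') \<in> soft_O (\<lambda>_. real 1)"
    by (rule soft_O_ceillog2[where g = "\<lambda>_. 1"]) (use time_bound_le[OF _ A(1)] in simp)
  then have \<tau>: "(\<lambda>_. time_bound A A') \<in> soft_O (\<lambda>_. 1)" by simp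
  have main: "\<exists>st :: bool stream \<Rightarrow> nat \<Rightarrow> state.
           (\<forall>\<omega>. is_run (word_length \<kappa> n) (space_bound A A' n) (time_bound A A' n) (main_prog A A') n T upd \<omega> (st \<omega>) \<and>
             (\<forall>t\<le>T. stored_within (space_bound A A' n) (st \<omega> t) \<and>
                stored_edges (st \<omega> t) \<subseteq> graph_edges upd t)) \<and>
           measure coins {\<omega>. \<forall>t\<le>T.
             real (card (graph_edges upd t)) \<le> 8 * \<alpha> * c\<^sup>2 * real n * (log 2 (real n))\<^sup>2 \<longrightarrow>
             stored_edges (st \<omega> t) = graph_edges upd t} \<ge> 1 - 1 / real n powr d"
    if \<epsilon>: "0 < \<epsilon>" "\<epsilon> < 1" and n: "2 \<le> n" and \<alpha>: "\<alpha> = 2 + cs * \<epsilon>"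
      and T: "T = nat \<lceil>real n powr lam\<rceil>" and legal: "legal_stream n T upd" for \<epsilon> \<alpha> n T upd
  proof -
    define V :: "nat \<Rightarrow> nat set" where "V t = edge_id (2 ^ ceillog2 n) ` graph_edges upd t" for t
    let ?rec = "\<lambda>\<omega> t. id_edge (2 ^ ceillog2 n) ` recovered (num_reps A' n) (hash_bits A n)
      (ceillog2 n + ceillog2 n) (\<lambda>i. of_bool (\<omega> !! i)) (V t)"
    have "\<exists>st. is_run (word_length \<kappa> n) (space_bound A A' n) (time_bound A A' n) (main_prog A A') n T upd \<omega> st \<and>
      (\<forall>t\<le>T. stored_within (space_bound A A' n) (st t) \<and> stored_edges (st t) = ?rec \<omega> t)" for \<omega>
      using stream_run[OF n A(1) A'(2) \<kappa>_def legal V_def, of \<omega>] by metis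
    then obtain st where st: "is_run (word_length \<kappa> n) (space_bound A A' n) (time_bound A A' n)
        (main_prog A A') n T upd \<omega> (st \<omega>)"
      "t \<le> T \<Longrightarrow> stored_within (space_bound A A' n) (st \<omega> t)"
      "t \<le> T \<Longrightarrow> stored_edges (st \<omega> t) = ?rec \<omega> t" for \<omega> t by metis
    \<comment> \<open>True for every outcome of the coins: recovered identifiers belong to present
      edges, and decoding inverts \<open>edge_id\<close>.\<close>
    have "?rec \<omega> t \<subseteq> graph_edges upd t" if "t \<le> T" for \<omega> t
    proof -
      have "n \<le> 2 ^ ceillog2 n" using two_power_ceillog2[of n] n by simp
      then have "graph_edges upd t \<subseteq> edges_on (2 ^ ceillog2 n)"
        using graph_edges_on[OF legal that] edges_on_mono by blast
      then show ?thesis using id_edge_id by (fastforce simp: V_def recovered_def)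
    qed
    moreover have "16 * \<alpha> * c\<^sup>2 \<le> real A"
    proof -
      have "cs * \<epsilon> \<le> \<bar>cs\<bar> * 1" using \<epsilon> by (intro mult_mono) auto
      then have "16 * \<alpha> * c\<^sup>2 \<le> 16 * (2 + \<bar>cs\<bar>) * c\<^sup>2" by (intro mult_right_mono) (simp_all add: \<alpha>)
      then show ?thesis using A(2) by linarith
    qed
    ultimately show ?thesis
      using stream_success[OF n A(1) A'(2) _ A'(1) assms(1) T legal st(3)[unfolded V_def]] st
      by (intro exI[of _ st]) auto
  qed
  show ?thesis
    unfolding Let_def
    using S \<tau> main by blast
qed

end
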